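(* Let $K, L \subset \mathbb{R}^2$ be compact convex sets with non-empty interior that are centrally symmetric, i.e. $K = -K$ and $L = -L$. Then the function $\mathbb{R} \to (0,\infty)$, $t \mapsto |e^t K \cap L|$, is log-concave; that is, for all $s, t \in \mathbb{R}$ and all $\lambda \in [0,1]$, $$ |e^{(1-\lambda)s + \lambda t} K \cap L| \ \ge\ |e^s K \cap L|^{1-\lambda}\, |e^t K \cap L|^{\lambda}. $$
   Context: $|\cdot|$ denotes Lebesgue measure (area) on $\mathbb{R}^2$. For $r > 0$ and $K \subset \mathbb{R}^2$, $rK = \{ r x : x \in K\}$. $-K = \{-x : x \in K\}$. *)

theory Defs
  imports "HOL-Analysis.Analysis"
begin

end

theory Submission
  imports Defs "HOL-Real_Asymp.Real_Asymp"
begin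

text \<open>
  Write \<open>K = {N \<le> 1}\<close> and \<open>L = {M \<le> 1}\<close> for norms \<open>N\<close>, \<open>M\<close> of the plane, and let
  \<open>h r\<close> be the area of \<open>r K \<inter> L = {N \<le> r, M \<le> 1}\<close>. The rays from the origin are divided by the
  sign of \<open>N - r M\<close>: where \<open>N > r M\<close> the ray leaves \<open>r K\<close> first, elsewhere it leaves \<open>L\<close> first.
  Accordingly \<open>h = k + j\<close>, where \<open>k r\<close> is the area of the part of \<open>r K\<close> with \<open>N > r M\<close>, and
  \<open>j r\<close> the area of the part of \<open>L\<close> with \<open>N \<le> r M\<close>. Only the first part grows with \<open>r\<close>, at
  the rate of a dilation, so that the derivative of \<open>ln h\<close> with respect to \<open>ln r\<close> is \<open>2 k / h\<close>.
  Log-concavity thus says that \<open>k / (k + j)\<close> is nonincreasing. More is true: as long as both kinds of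
  rays occur, \<open>k r / r\<close> is nonincreasing and \<open>j r / r\<close> is nondecreasing. The second claim is the
  first one with the two norms exchanged and \<open>r\<close> replaced by \<open>1 / r\<close>.

  The first claim is additive over sectors. The rays with \<open>N > M\<close> form open sectors, and these are
  narrower than a half-plane because some line has \<open>N < M\<close>. On the sides of such a sector, spanned by
  \<open>p\<close> and \<open>q\<close>, the two norms agree, and they may be scaled to be \<open>1\<close> there. All that is needed
  about \<open>M\<close> is that \<open>M (x p + y q) \<ge> \<bar>x - y\<bar>\<close>, which is the triangle inequality. In the
  coordinates \<open>u = x - y\<close>, \<open>v = x + y\<close> the part of the unit ball \<open>{N \<le> 1}\<close> in the sector is
  the region between \<open>v = \<bar>u\<bar>\<close> and the graph of a concave function \<open>f\<close> on \<open>[-1, 1]\<close>, and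
  one compares it with its subset where \<open>S \<bar>u\<bar> \<le> N\<close>. For \<open>a = 1 / S\<close> this subset is,
  over \<open>[-a, a]\<close>, the region between the graph and the rays to the points \<open>(\<plusminus>a, f (\<plusminus>a))\<close>.
  Stretching it horizontally by the factor \<open>S\<close> multiplies its area by \<open>S\<close>, and
  every vertical slice of the result is at most as long as the corresponding slice of the whole sector:
  \<open>f (a t) - t f a \<le> f t - t f 1\<close> for \<open>0 \<le> t \<le> 1\<close>, and symmetrically for
  negative \<open>t\<close>, which is a case of concavity
  (lemmas \<open>slice_le_nonneg\<close>, \<open>cone_contraction\<close>, \<open>sector_contraction\<close>).
  Summing over the sectors gives \<open>plane_contraction\<close>, from which \<open>balls_log_concave\<close> follows.
\<close>

section \<open>Norms as functions\<close>

definition is_norm :: "('a::real_vector \<Rightarrow> real) \<Rightarrow> bool" where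
  "is_norm N \<longleftrightarrow> (\<forall>x. x \<noteq> 0 \<longrightarrow> N x > 0) \<and> (\<forall>c x. N (c *\<^sub>R x) = \<bar>c\<bar> * N x)
     \<and> (\<forall>x y. N (x + y) \<le> N x + N y)"

lemma is_norm_pos: "is_norm N \<Longrightarrow> x \<noteq> 0 \<Longrightarrow> N x > 0"
  and is_norm_scale: "is_norm N \<Longrightarrow> N (c *\<^sub>R x) = \<bar>c\<bar> * N x"
  and is_norm_triangle: "is_norm N \<Longrightarrow> N (x + y) \<le> N x + N y"
  by (auto simp: is_norm_def)

lemma is_norm_zero: "is_norm N \<Longrightarrow> N 0 = 0"
  using is_norm_scale[of N 0 0] by simp

lemma is_norm_nonneg: "is_norm N \<Longrightarrow> N x \<ge> 0"
  using is_norm_pos[of N x] is_norm_zero[of N] by (cases "x = 0") auto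

lemma is_norm_minus: "is_norm N \<Longrightarrow> N (- x) = N x"
  using is_norm_scale[of N "-1" x] by simp

lemma is_norm_combine:
  "is_norm N \<Longrightarrow> N (c *\<^sub>R x + d *\<^sub>R y) \<le> \<bar>c\<bar> * N x + \<bar>d\<bar> * N y"
  using is_norm_triangle[of N "c *\<^sub>R x" "d *\<^sub>R y"] by (simp add: is_norm_scale)

lemma is_norm_ball_mix:
  assumes "is_norm N" "N x \<le> 1" "N y \<le> 1" "0 \<le> t" "t \<le> 1"
  shows "N ((1 - t) *\<^sub>R x + t *\<^sub>R y) \<le> 1"
proof -
  have "N ((1 - t) *\<^sub>R x + t *\<^sub>R y) \<le> (1 - t) * N x + t * N y"
    using is_norm_combine[OF assms(1), of "1 - t" x t y] assms by simp
  also have "\<dots> \<le> 1"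
    using assms convex_bound_le[of "N x" 1 "N y" "1 - t" t] by auto
  finally show ?thesis .
qed

lemma is_norm_convex_on: "is_norm N \<Longrightarrow> convex_on UNIV N"
proof (rule convex_onI)
  fix t x y assume "is_norm N" "0 < (t::real)" "t < 1"
  then show "N ((1 - t) *\<^sub>R x + t *\<^sub>R y) \<le> (1 - t) * N x + t * N y"
    using is_norm_combine[of N "1 - t" x t y] by simp
qed simp

lemma is_norm_continuous:
  fixes N :: "'a::euclidean_space \<Rightarrow> real"
  shows "is_norm N \<Longrightarrow> continuous_on UNIV N"
  by (rule convex_on_continuous[OF open_UNIV is_norm_convex_on])

lemma is_norm_borel:
  fixes N :: "'a::euclidean_space \<Rightarrow> real"
  shows "is_norm N \<Longrightarrow> N \<in> borel_measurable borel"
  by (rule borel_measurable_continuous_onI[OF is_norm_continuous])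

lemma is_norm_bounded_ball:
  fixes N :: "'a::euclidean_space \<Rightarrow> real"
  assumes N: "is_norm N"
  shows "bounded {x. N x \<le> r}"
proof -
  obtain z where z: "z \<in> sphere 0 1" "\<And>x. x \<in> sphere 0 1 \<Longrightarrow> N z \<le> N (x::'a)"
    using continuous_attains_inf[of "sphere (0::'a) 1" N] is_norm_continuous[OF N]
      continuous_on_subset by force
  have "z \<noteq> 0" using z(1) by auto
  then have pos: "N z > 0" by (rule is_norm_pos[OF N])
  have "norm x \<le> r / N z" if "N x \<le> r" for x
  proof (cases "x = 0")
    case True
    then show ?thesis using that is_norm_zero[OF N] pos by simp
  next
    case False
    have "N z \<le> N ((1 / norm x) *\<^sub>R x)" using False by (intro z) simp
    also have "\<dots> = N x / norm x" by (simp add: is_norm_scale[OF N])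
    finally show ?thesis using that pos False by (simp add: field_simps)
  qed
  then show ?thesis unfolding bounded_iff by blast
qed

section \<open>Comparison of slices\<close>

lemma is_norm_slice_max:
  fixes N :: "real \<times> real \<Rightarrow> real"
  assumes N: "is_norm N" and v0: "N (u, v0) \<le> 1"
  obtains y where "N (u, y) \<le> 1" "\<And>v. N (u, v) \<le> 1 \<Longrightarrow> v \<le> y"
proof -
  let ?A = "{v. N (u, v) \<le> 1}"
  have c: "continuous_on UNIV (\<lambda>v. N (u, v))"
    by (intro continuous_on_compose2[OF is_norm_continuous[OF N]] continuous_intros) auto
  have "closed ?A" by (intro closed_Collect_le c continuous_intros)
  moreover have "bounded ?A"
  proof -
    have "?A \<subseteq> snd ` {x. N x \<le> 1}" by force
    then show ?thesis using bounded_snd[OF is_norm_bounded_ball[OF N]] bounded_subset by blast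
  qed
  ultimately have "compact ?A" by (simp add: compact_eq_bounded_closed)
  then obtain y where "y \<in> ?A" "\<And>v. v \<in> ?A \<Longrightarrow> v \<le> y"
    using compact_attains_sup[of ?A] v0 by auto
  then show ?thesis using that by auto
qed

text \<open>
  Let \<open>f u\<close> be the largest \<open>v\<close> with \<open>N (u, v) \<le> 1\<close>. The slice on the left lies between
  \<open>t f a\<close> and \<open>f (a t)\<close>, because below the ray to \<open>(a, f a)\<close> the norm is too small. The slice
  on the right is the interval from \<open>t\<close> to \<open>f t\<close>. Both \<open>t\<close> and \<open>a\<close> are convex
  combinations of \<open>a t\<close> and \<open>1\<close>, so concavity of \<open>f\<close> together with \<open>f 1 \<ge> 1\<close> gives
  \<open>f (a t) - t f a \<le> f t - t\<close>.
\<close>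

lemma slice_le_nonneg:
  fixes N :: "real \<times> real \<Rightarrow> real"
  assumes N: "is_norm N" and p: "N (1, 1) = 1" and q: "N (-1, 1) = 1"
    and a: "0 < a" "a < 1" and t: "0 \<le> t" "t \<le> 1"
  shows "emeasure lborel {v. a * t < v \<and> N (a * t, v) \<le> 1 \<and> t \<le> N (a * t, v)}
       \<le> emeasure lborel {v. t < v \<and> N (t, v) \<le> 1}"
proof -
  have chord: "N (u, 1) \<le> 1" if "\<bar>u\<bar> \<le> 1" for u
    using is_norm_ball_mix[OF N, of "(-1,1)" "(1,1)" "(1 + u) / 2"] p q that
    by (simp add: field_simps)
  have at: "0 \<le> a * t" "a * t \<le> a" "a * t \<le> t" using a t mult_right_mono[of a 1 t] mult_left_mono[of t 1 a] by auto
  obtain y1 where y1: "N (a * t, y1) \<le> 1" "\<And>v. N (a * t, v) \<le> 1 \<Longrightarrow> v \<le> y1"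
    by (rule is_norm_slice_max[OF N chord[of "a * t"]]) (use at a in auto)
  obtain y2 where y2: "N (a, y2) \<le> 1" "\<And>v. N (a, v) \<le> 1 \<Longrightarrow> v \<le> y2"
    by (rule is_norm_slice_max[OF N chord[of a]]) (use a in auto)
  obtain y3 where y3: "N (t, y3) \<le> 1" "\<And>v. N (t, v) \<le> 1 \<Longrightarrow> v \<le> y3"
    by (rule is_norm_slice_max[OF N chord[of t]]) (use t in auto)
  have ge1: "y3 \<ge> 1" using y3(2) chord[of t] t by auto
  define d where "d = 1 - a * t"
  have d: "d > 0" using at(2) a(2) unfolding d_def by linarith
  \<comment> \<open>the weights with \<open>t = (1 - l) (a t) + l\<close> and \<open>a = (1 - m) (a t) + m\<close>\<close>
  define l where "l = t * (1 - a) / d"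
  define m where "m = a * (1 - t) / d"
  have l: "0 \<le> l" "l \<le> 1" and m: "0 \<le> m" "m \<le> 1"
  proof -
    have "t * (1 - a) \<le> d" "a * (1 - t) \<le> d"
      using a t unfolding d_def right_diff_distrib by (simp_all add: mult.commute)
    moreover have "0 \<le> t * (1 - a)" "0 \<le> a * (1 - t)" using a t by simp_all
    ultimately show "0 \<le> l" "l \<le> 1" "0 \<le> m" "m \<le> 1" using d by (simp_all add: l_def m_def)
  qed
  have ld: "l * d = t * (1 - a)" and md: "m * d = a * (1 - t)" using d by (auto simp: l_def m_def)
  have "N ((1 - l) *\<^sub>R (a * t, y1) + l *\<^sub>R (1, 1)) \<le> 1"
    using is_norm_ball_mix[OF N y1(1), of "(1,1)" l] p l by simp
  moreover have "(1 - l) * (a * t) + l = t" using ld by (simp add: d_def algebra_simps)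
  ultimately have y3': "(1 - l) * y1 + l \<le> y3" using y3(2) by simp
  have "N ((1 - m) *\<^sub>R (a * t, y1) + m *\<^sub>R (1, 1)) \<le> 1"
    using is_norm_ball_mix[OF N y1(1), of "(1,1)" m] p m by simp
  moreover have "(1 - m) * (a * t) + m = a" using md by (simp add: d_def algebra_simps)
  ultimately have y2': "(1 - m) * y1 + m \<le> y2" using y2(2) by simp
  have lm: "t * m + l = t"
  proof -
    have "(t * m + l) * d = t * (m * d) + l * d" by (simp add: algebra_simps)
    also have "\<dots> = t * d" unfolding ld md by (simp add: d_def algebra_simps)
    finally have "(t * m + l) * d = t * d" .
    then show ?thesis using d by simp
  qed
  have key: "y1 - t * y2 \<le> y3 - t"
  proof -
    have "y1 + t = t * ((1 - m) * y1 + m) + ((1 - l) * y1 + l)"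
    proof -
      have "t * ((1 - m) * y1 + m) + ((1 - l) * y1 + l) = t * y1 + y1 + (t * m + l) * (1 - y1)"
        by (simp add: algebra_simps)
      also have "\<dots> = y1 + t" unfolding lm by (simp add: algebra_simps)
      finally show ?thesis by simp
    qed
    also have "\<dots> \<le> t * y2 + y3"
      using mult_left_mono[OF y2' t(1)] y3' by simp
    finally show ?thesis by simp
  qed
  \<comment> \<open>on the segment from \<open>(a, a)\<close>, of norm \<open>a < 1\<close>,
    up to \<open>(a, y2)\<close> the norm stays below 1 except at the end\<close>
  have low: "t * y2 \<le> v" if v: "a * t < v" "t \<le> N (a * t, v)" for v
  proof (rule ccontr)
    assume less: "\<not> t * y2 \<le> v"
    with v at have "t > 0" using t by (cases "t = 0") auto
    define w where "w = v / t"
    have w: "a < w" "w < y2" using less v \<open>t > 0\<close> by (auto simp: w_def field_simps)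
    have e: "t *\<^sub>R (a, w) = (a * t, v)" using \<open>t > 0\<close> by (simp add: w_def)
    have "N (a * t, v) = t * N (a, w)"
      using is_norm_scale[OF N, of t "(a, w)"] \<open>t > 0\<close> unfolding e by simp
    then have "1 \<le> N (a, w)" using v \<open>t > 0\<close> by simp
    moreover have "N (a, w) < 1"
    proof -
      define n where "n = (w - a) / (y2 - a)"
      have n: "0 < n" "n < 1" using w by (auto simp: n_def)
      have "(a, w) = ((1 - n) * a) *\<^sub>R (1, 1) + n *\<^sub>R (a, y2)"
      proof -
        have "n * (y2 - a) = w - a" using w by (simp add: n_def)
        then show ?thesis by (simp add: algebra_simps)
      qed
      then have "N (a, w) \<le> (1 - n) * a + n * N (a, y2)"
        using is_norm_combine[OF N, of "(1 - n) * a" "(1, 1)" n "(a, y2)"] p n a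
        unfolding \<open>(a, w) = _\<close> by (simp add: abs_mult)
      also have "\<dots> \<le> (1 - n) * a + n * 1" using y2 n by (intro add_mono mult_left_mono) auto
      also have "\<dots> < 1"
      proof -
        have "(1 - n) * a < (1 - n) * 1" using n a by (intro mult_strict_left_mono) auto
        then show ?thesis by (simp only: mult_1_right less_diff_eq)
      qed
      finally show ?thesis .
    qed
    ultimately show False by simp
  qed
  have up: "N (t, v) \<le> 1" if "t < v" "v \<le> y3" for v
  proof -
    define n where "n = (v - t) / (y3 - t)"
    have n: "0 \<le> n" "n \<le> 1" using that by (auto simp: n_def field_simps)
    have "n * (y3 - t) = v - t" using that by (simp add: n_def)
    then have "(t, v) = (1 - n) *\<^sub>R (t, t) + n *\<^sub>R (t, y3)" by (simp add: algebra_simps)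
    moreover have "N (t, t) \<le> 1" using is_norm_scale[OF N, of t "(1,1)"] p t by simp
    ultimately show ?thesis using is_norm_ball_mix[OF N, of "(t,t)" "(t,y3)" n] y3 n by simp
  qed
  have N1: "(\<lambda>v. N (u, v)) \<in> borel_measurable borel" for u
    using is_norm_borel[OF N] by measurable
  have "emeasure lborel {v. a * t < v \<and> N (a * t, v) \<le> 1 \<and> t \<le> N (a * t, v)}
      \<le> emeasure lborel {t * y2 .. y1}"
    using low y1 by (intro emeasure_mono) auto
  also have "\<dots> \<le> ennreal (y3 - t)" 
    using key t ge1 by (cases "t * y2 \<le> y1") (auto intro!: ennreal_leI)
  also have "\<dots> = emeasure lborel {t <.. y3}" using t ge1 by simp
  also have "\<dots> \<le> emeasure lborel {v. t < v \<and> N (t, v) \<le> 1}"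
    using up N1[of t] by (intro emeasure_mono) auto
  finally show ?thesis .
qed
lemma is_norm_reflect:
  fixes N :: "real \<times> real \<Rightarrow> real"
  assumes N: "is_norm N"
  shows "is_norm (\<lambda>x. N (- fst x, snd x))"
proof -
  have "N (- (a + b), v + w) \<le> N (- a, v) + N (- b, w)" for a b v w
    using is_norm_triangle[OF N, of "(- a, v)" "(- b, w)"] by simp
  moreover have "N (- (c * a), c * v) = \<bar>c\<bar> * N (- a, v)" for c a v
    using is_norm_scale[OF N, of c "(- a, v)"] by simp
  moreover have "N (- a, v) > 0" if "a \<noteq> 0 \<or> v \<noteq> 0" for a v
    using is_norm_pos[OF N, of "(- a, v)"] that by (auto simp: zero_prod_def)
  ultimately show ?thesis unfolding is_norm_def by (auto simp: zero_prod_def)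
qed

lemma slice_le:
  fixes N :: "real \<times> real \<Rightarrow> real"
  assumes N: "is_norm N" and p: "N (1, 1) = 1" and q: "N (-1, 1) = 1"
    and a: "0 < a" "a < 1"
  shows "emeasure lborel {v. \<bar>a * t\<bar> < v \<and> N (a * t, v) \<le> 1 \<and> \<bar>t\<bar> \<le> N (a * t, v)}
       \<le> emeasure lborel {v. \<bar>t\<bar> < v \<and> N (t, v) \<le> 1}"
proof (cases "\<bar>t\<bar> \<le> 1")
  case False
  then have "{v. \<bar>a * t\<bar> < v \<and> N (a * t, v) \<le> 1 \<and> \<bar>t\<bar> \<le> N (a * t, v)} = {}" by auto
  then show ?thesis by (metis emeasure_empty zero_le)
next
  case True
  show ?thesis
  proof (cases "t \<ge> 0")
    case True
    then show ?thesis using slice_le_nonneg[OF N p q a, of t] \<open>\<bar>t\<bar> \<le> 1\<close> a by simp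
  next
    case False
    then have "- (a * t) > 0" using a by (simp add: mult_less_0_iff)
    then show ?thesis
      using slice_le_nonneg[OF is_norm_reflect[OF N] _ _ a, of "- t"] p q \<open>\<bar>t\<bar> \<le> 1\<close> False
      by simp
  qed
qed

section \<open>From slices to areas\<close>

lemma sets_cone:
  fixes N :: "real \<times> real \<Rightarrow> real"
  assumes N: "is_norm N"
  shows "{x. \<bar>fst x\<bar> < snd x \<and> N x \<le> 1 \<and> S * \<bar>fst x\<bar> \<le> N x} \<in> sets borel" (is ?A)
    and "{x. \<bar>fst x\<bar> < snd x \<and> N x \<le> 1} \<in> sets borel" (is ?B)
proof -
  have [measurable]: "N \<in> borel_measurable borel" using N by (rule is_norm_borel)
  have [measurable]: "fst \<in> borel_measurable (borel :: (real \<times> real) measure)"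
    "snd \<in> borel_measurable (borel :: (real \<times> real) measure)"
    by (auto intro!: borel_measurable_continuous_onI continuous_intros)
  show ?A
    by measurable
  show ?B by measurable
qed

text \<open>
  Fubini: the slice of the smaller set at \<open>a t\<close>, where \<open>a = 1 / S\<close>, is compared with the slice
  of the larger set at \<open>t\<close>. The substitution \<open>u = a t\<close> produces the factor \<open>S\<close>.
\<close>

lemma cone_contraction:
  fixes N :: "real \<times> real \<Rightarrow> real"
  assumes N: "is_norm N" and p: "N (1, 1) = 1" and q: "N (-1, 1) = 1" and S: "S > 1"
  shows "ennreal S * emeasure lborel {x. \<bar>fst x\<bar> < snd x \<and> N x \<le> 1 \<and> S * \<bar>fst x\<bar> \<le> N x}
    \<le> emeasure lborel {x. \<bar>fst x\<bar> < snd x \<and> N x \<le> 1}"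
    (is "_ * emeasure _ ?A \<le> emeasure _ ?B")
proof -
  define a where "a = 1 / S"
  have a: "0 < a" "a < 1" "S * a = 1" using S by (auto simp: a_def)
  have A: "?A \<in> sets borel" and B: "?B \<in> sets borel" by (rule sets_cone[OF N])+
  have Am: "?A \<in> sets (lborel \<Otimes>\<^sub>M lborel)" and Bm: "?B \<in> sets (lborel \<Otimes>\<^sub>M lborel)"
    using A B by (simp_all only: lborel_prod sets_lborel)
  define g where "g u = emeasure lborel (Pair u -` ?A)" for u :: real
  have g: "g \<in> borel_measurable borel"
    using lborel.measurable_emeasure_Pair[OF Am] by (simp add: g_def[abs_def])
  have "emeasure lborel ?A = (\<integral>\<^sup>+u. g u \<partial>lborel)"
    using lborel.emeasure_pair_measure_alt[OF Am] by (simp add: lborel_prod g_def)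
  also have "\<dots> = ennreal a * (\<integral>\<^sup>+t. g (a * t) \<partial>lborel)"
    using nn_integral_real_affine[OF g, of a 0] a by simp
  finally have "ennreal S * emeasure lborel ?A = (\<integral>\<^sup>+t. g (a * t) \<partial>lborel)"
    using a S by (simp add: mult.assoc[symmetric] ennreal_mult[symmetric])
  also have "\<dots> \<le> (\<integral>\<^sup>+t. emeasure lborel (Pair t -` ?B) \<partial>lborel)"
  proof (rule nn_integral_mono)
    fix t :: real
    have "S * \<bar>a * t\<bar> = \<bar>t\<bar>" using a S by (simp add: abs_mult mult.assoc[symmetric])
    then have "Pair (a * t) -` ?A = {v. \<bar>a * t\<bar> < v \<and> N (a * t, v) \<le> 1 \<and> \<bar>t\<bar> \<le> N (a * t, v)}"
      by auto
    moreover have "Pair t -` ?B = {v. \<bar>t\<bar> < v \<and> N (t, v) \<le> 1}" by auto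
    ultimately show "g (a * t) \<le> emeasure lborel (Pair t -` ?B)"
      unfolding g_def using slice_le[OF N p q a(1,2), of t] by simp
  qed
  also have "\<dots> = emeasure lborel ?B"
    using lborel.emeasure_pair_measure_alt[OF Bm] by (simp add: lborel_prod)
  finally show ?thesis .
qed

section \<open>Linear coordinates of the plane\<close>

definition vec2 :: "real \<times> real \<Rightarrow> real^2" where
  "vec2 x = (\<chi> i. if i = 1 then fst x else snd x)"

lemma vec2_nth [simp]: "vec2 x $ 1 = fst x" "vec2 x $ 2 = snd x"
  by (simp_all add: vec2_def)

lemma measurable_vec2 [measurable]: "vec2 \<in> measurable lborel borel"
proof -
  have "continuous_on UNIV (\<lambda>x::real\<times>real. if i = 1 then fst x else snd x)" for i :: 2
    by (cases "i = 1") (auto intro: continuous_intros)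
  then have "continuous_on UNIV vec2"
    unfolding vec2_def[abs_def] by (rule continuous_on_vec_lambda)
  then show ?thesis by (simp add: borel_measurable_continuous_onI)
qed

lemma distr_vec2: "distr lborel borel vec2 = lborel"
proof (rule lborel_eqI[symmetric])
  fix l u :: "real^2" assume le: "\<And>b. b \<in> Basis \<Longrightarrow> l \<bullet> b \<le> u \<bullet> b"
  have le12: "l $ 1 \<le> u $ 1" "l $ 2 \<le> u $ 2"
    using le[of "axis 1 1"] le[of "axis 2 1"] by (auto simp: axis_in_Basis_iff inner_axis)
  have "vec2 -` box l u = box (l $ 1, l $ 2) (u $ 1, u $ 2)"
    by (auto simp: mem_box_cart forall_2 box_prod box_real)
  then have "emeasure (distr lborel borel vec2) (box l u)
      = emeasure lborel (box (l $ 1, l $ 2) (u $ 1, u $ 2))"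
    by (simp add: emeasure_distr)
  also have "\<dots> = ennreal ((u $ 1 - l $ 1) * (u $ 2 - l $ 2))"
  proof -
    have B: "Basis = {(1, 0), (0, 1) :: real \<times> real}" by (auto simp: Basis_prod_def)
    then show ?thesis using le12 by (simp add: emeasure_lborel_box_eq B)
  qed
  also have "(u $ 1 - l $ 1) * (u $ 2 - l $ 2) = (\<Prod>b\<in>Basis. (u - l) \<bullet> b)"
  proof -
    have B: "Basis = {axis 1 1, axis 2 1 :: real^2}"
      unfolding Basis_vec_def by (auto; metis exhaust_2)
    have "axis 1 1 \<noteq> (axis 2 1 :: real^2)" by (simp add: axis_eq_axis)
    then show ?thesis unfolding B by (simp add: inner_axis)
  qed
  finally show "emeasure (distr lborel borel vec2) (box l u) = (\<Prod>b\<in>Basis. (u - l) \<bullet> b)" .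
qed simp

lemma emeasure_bounded_borel:
  assumes "B \<in> sets borel" "bounded B"
  shows "emeasure lborel B = ennreal (measure lebesgue (B :: 'a::euclidean_space set))"
  using assms emeasure_bounded_finite[of B] emeasure_eq_ennreal_measure[of lborel B]
  by (simp add: less_top)

definition indep2 :: "'a::real_vector \<Rightarrow> 'a \<Rightarrow> bool" where
  "indep2 p q \<longleftrightarrow> (\<forall>x y. x *\<^sub>R p + y *\<^sub>R q = 0 \<longrightarrow> x = 0 \<and> y = 0)"

lemma indep2D: "indep2 p q \<Longrightarrow> x *\<^sub>R p + y *\<^sub>R q = 0 \<Longrightarrow> x = 0 \<and> y = 0"
  by (auto simp: indep2_def)

lemma indep2_unique:
  assumes "indep2 p q" "x *\<^sub>R p + y *\<^sub>R q = x' *\<^sub>R p + y' *\<^sub>R q"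
  shows "x = x' \<and> y = y'"
  using indep2D[OF assms(1), of "x - x'" "y - y'"] assms(2)
  by (simp add: scaleR_left_diff_distrib algebra_simps)

lemma indep2_linear_map:
  fixes p q :: "real^2"
  assumes ind: "indep2 p q"
  defines "f \<equiv> \<lambda>y :: real^2. y $ 1 *\<^sub>R p + y $ 2 *\<^sub>R q"
  shows "linear f" "inj f" "surj f"
proof -
  show lin: "linear f" by (rule linearI) (simp_all add: f_def algebra_simps)
  show inj: "inj f"
    unfolding linear_injective_0[OF lin]
  proof (intro allI impI)
    fix y assume "f y = 0"
    then show "y = 0" using indep2D[OF ind, of "y $ 1" "y $ 2"] by (simp add: f_def vec_eq_iff forall_2)
  qed
  show "surj f" using lin inj linear_injective_imp_surjective by blast
qed

lemma indep2_coordinates: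
  fixes p q :: "real^2"
  assumes "indep2 p q"
  obtains x y where "z = x *\<^sub>R p + y *\<^sub>R q"
  using surjD[OF indep2_linear_map(3)[OF assms], of z] by blast

lemma open_indep2_image:
  fixes p q :: "real^2"
  assumes ind: "indep2 p q" and A: "open A"
  shows "open {x *\<^sub>R p + y *\<^sub>R q | x y. (x, y) \<in> A}"
proof -
  let ?f = "\<lambda>y :: real^2. y $ 1 *\<^sub>R p + y $ 2 *\<^sub>R q"
  have "open ((\<lambda>y :: real^2. (y $ 1, y $ 2)) -` A)"
    by (intro open_vimage A continuous_intros)
  then have "open (?f ` ((\<lambda>y. (y $ 1, y $ 2)) -` A))"
    using indep2_linear_map[OF ind] by (intro open_surjective_linear_image) auto
  moreover have "?f ` ((\<lambda>y. (y $ 1, y $ 2)) -` A) = {x *\<^sub>R p + y *\<^sub>R q | x y. (x, y) \<in> A}"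
  proof safe
    fix x y assume "(x, y) \<in> A"
    then show "x *\<^sub>R p + y *\<^sub>R q \<in> ?f ` ((\<lambda>y. (y $ 1, y $ 2)) -` A)"
      by (intro image_eqI[of _ _ "vec2 (x, y)"]) auto
  qed auto
  ultimately show ?thesis by simp
qed

text \<open>
  Since a linear chart multiplies all areas by the same constant, inequalities that are homogeneous in
  the area can be transported to the product of two lines, where Fubini applies.
\<close>

lemma chart_measure:
  fixes P Q :: "real^2"
  assumes ind: "indep2 P Q"
  obtains c where "c > 0" "\<And>B. B \<in> sets borel \<Longrightarrow> bounded B \<Longrightarrow>
    emeasure lborel B = ennreal c * emeasure lborel {x. fst x *\<^sub>R P + snd x *\<^sub>R Q \<in> B}"
proof -
  define f where "f y = y $ 1 *\<^sub>R P + y $ 2 *\<^sub>R Q" for y :: "real^2"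
  have lin: "linear f" and inj: "inj f" and surj: "surj f"
    using indep2_linear_map[OF ind] by (simp_all add: f_def[abs_def])
  define c where "c = \<bar>det (matrix f)\<bar>"
  have c: "c > 0" using inj det_nz_iff_inj[OF lin] by (simp add: c_def)
  show ?thesis
  proof (rule that[OF c])
    fix B :: "(real^2) set" assume B: "B \<in> sets borel" "bounded B"
    define C where "C = f -` B"
    have CB: "f ` C = B" using surj by (simp add: C_def)
    have "continuous_on UNIV f" by (rule linear_continuous_on_compose[OF continuous_on_id lin])
    then have "f \<in> borel_measurable borel" by (rule borel_measurable_continuous_onI)
    from measurable_sets[OF this B(1)] have Cb: "C \<in> sets borel" by (simp add: C_def)
    have "C = inv f ` B" using inj surj by (simp add: C_def bij_def bij_vimage_eq_inv_image)
    moreover have "linear (inv f)" by (rule inj_linear_imp_inv_linear[OF lin inj])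
    ultimately have bC: "bounded C" using bounded_linear_image[OF B(2)] by (simp add: linear_linear)
    have Cl: "C \<in> lmeasurable" using Cb bC by (intro bounded_set_imp_lmeasurable) auto
    have "emeasure lborel B = ennreal (measure lebesgue B)"
      by (rule emeasure_bounded_borel[OF B])
    also have "\<dots> = ennreal c * ennreal (measure lebesgue C)"
      using measure_linear_image[OF lin Cl] CB by (simp add: c_def ennreal_mult)
    also have "ennreal (measure lebesgue C) = emeasure lborel C"
      using emeasure_bounded_borel[OF Cb bC] by simp
    also have "emeasure lborel C = emeasure (distr lborel borel vec2) C" by (simp add: distr_vec2)
    also have "\<dots> = emeasure lborel {x. fst x *\<^sub>R P + snd x *\<^sub>R Q \<in> B}"
      using Cb by (simp add: emeasure_distr C_def f_def vimage_def)
    finally show "emeasure lborel B = ennreal c * emeasure lborel {x. fst x *\<^sub>R P + snd x *\<^sub>R Q \<in> B}" .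
  qed
qed
section \<open>Sectors on whose sides the two norms agree\<close>

definition sector :: "'a::real_vector \<Rightarrow> 'a \<Rightarrow> 'a set" where
  "sector p q = {x *\<^sub>R p + y *\<^sub>R q | x y. 0 < x \<and> 0 < y}"

lemma open_sector: "indep2 p q \<Longrightarrow> open (sector p (q :: real^2))"
proof -
  have "open ({0<..} \<times> {0<..} :: (real \<times> real) set)" by (intro open_Times) auto
  then show "indep2 p q \<Longrightarrow> open (sector p q)"
    using open_indep2_image[of p q "{0<..} \<times> {0<..}"] by (simp add: sector_def)
qed

lemma sets_norm_le:
  fixes N :: "'a::euclidean_space \<Rightarrow> real"
  assumes "is_norm N" "is_norm M"
  shows "{x. N x \<le> r} \<in> sets borel" "{x. s * M x \<le> N x} \<in> sets borel" "{x. s * M x < N x} \<in> sets borel"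
  using is_norm_borel[OF assms(1)] is_norm_borel[OF assms(2)] by measurable

text \<open>
  The point \<open>x p\<close> is the sum of \<open>x p + y q\<close> and \<open>- y q\<close>, hence
  \<open>x \<le> M (x p + y q) + y\<close>. In the main argument this is the only information about the second
  norm inside a sector. It encodes that the second ball contains the points \<open>\<plusminus>p\<close>, \<open>\<plusminus>q\<close> on
  its boundary, the antipodes included.
\<close>

lemma is_norm_coord_diff:
  assumes M: "is_norm M" and p: "M p = 1" and q: "M q = 1" and xy: "0 \<le> x" "0 \<le> y"
  shows "\<bar>x - y\<bar> \<le> M (x *\<^sub>R p + y *\<^sub>R q)"
proof -
  have "M (x *\<^sub>R p) \<le> M (x *\<^sub>R p + y *\<^sub>R q) + M (- (y *\<^sub>R q))"
    using is_norm_triangle[OF M, of "x *\<^sub>R p + y *\<^sub>R q" "- (y *\<^sub>R q)"] by simp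
  moreover have "M (y *\<^sub>R q) \<le> M (x *\<^sub>R p + y *\<^sub>R q) + M (- (x *\<^sub>R p))"
    using is_norm_triangle[OF M, of "x *\<^sub>R p + y *\<^sub>R q" "- (x *\<^sub>R p)"] by simp
  ultimately show ?thesis using xy by (simp add: is_norm_minus[OF M] is_norm_scale[OF M] p q)
qed

lemma is_norm_indep2_comp:
  assumes N: "is_norm N" and ind: "indep2 P Q"
  shows "is_norm (\<lambda>z. N (fst z *\<^sub>R P + snd z *\<^sub>R Q))"
proof -
  have "N (fst z *\<^sub>R P + snd z *\<^sub>R Q) > 0" if "z \<noteq> 0" for z :: "real \<times> real"
    using that indep2D[OF ind, of "fst z" "snd z"] by (intro is_norm_pos[OF N]) (auto simp: prod_eq_iff)
  moreover have "N (fst (c *\<^sub>R z) *\<^sub>R P + snd (c *\<^sub>R z) *\<^sub>R Q) = \<bar>c\<bar> * N (fst z *\<^sub>R P + snd z *\<^sub>R Q)"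
    for c and z :: "real \<times> real"
    using is_norm_scale[OF N, of c "fst z *\<^sub>R P + snd z *\<^sub>R Q"] by (simp add: scaleR_right_distrib)
  moreover have "N (fst (y + z) *\<^sub>R P + snd (y + z) *\<^sub>R Q)
      \<le> N (fst y *\<^sub>R P + snd y *\<^sub>R Q) + N (fst z *\<^sub>R P + snd z *\<^sub>R Q)" for y z :: "real \<times> real"
    using is_norm_triangle[OF N, of "fst y *\<^sub>R P + snd y *\<^sub>R Q" "fst z *\<^sub>R P + snd z *\<^sub>R Q"]
    by (simp add: scaleR_left_distrib algebra_simps)
  ultimately show ?thesis unfolding is_norm_def by blast
qed

text \<open>
  The chart with \<open>(1, 1) \<mapsto> p\<close> and \<open>(-1, 1) \<mapsto> q\<close> sends the cone \<open>\<bar>u\<bar> < v\<close> to the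
  sector. There \<open>\<bar>u\<bar> \<le> M\<close>, so the condition \<open>S M \<le> N\<close> implies \<open>S \<bar>u\<bar> \<le> N\<close>.
\<close>

lemma sector_contraction_normalised:
  fixes N M :: "real^2 \<Rightarrow> real"
  assumes N: "is_norm N" and M: "is_norm M" and ind: "indep2 p q"
    and p: "N p = 1" "M p = 1" and q: "N q = 1" "M q = 1" and S: "S > 1"
  shows "ennreal S * emeasure lborel {x \<in> sector p q. N x \<le> 1 \<and> S * M x \<le> N x}
    \<le> emeasure lborel {x \<in> sector p q. N x \<le> 1}"
proof -
  define P where "P = (1/2) *\<^sub>R (p - q)"
  define Q where "Q = (1/2) *\<^sub>R (p + q)"
  define T where "T z = fst z *\<^sub>R P + snd z *\<^sub>R Q" for z :: "real \<times> real"
  have T: "T z = ((snd z + fst z) / 2) *\<^sub>R p + ((snd z - fst z) / 2) *\<^sub>R q" for z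
    by (simp add: T_def P_def Q_def scaleR_right_diff_distrib scaleR_right_distrib
        scaleR_left_distrib add_divide_distrib diff_divide_distrib algebra_simps)
  have ind': "indep2 P Q"
    unfolding indep2_def
  proof (intro allI impI)
    fix u v assume "u *\<^sub>R P + v *\<^sub>R Q = 0"
    then have "((v + u) / 2) *\<^sub>R p + ((v - u) / 2) *\<^sub>R q = 0" using T[of "(u, v)"] by (simp add: T_def)
    from indep2D[OF ind this] show "u = 0 \<and> v = 0" by simp
  qed
  have NT: "is_norm (\<lambda>z. N (T z))" unfolding T_def by (rule is_norm_indep2_comp[OF N ind'])
  have T1: "T (1, 1) = p" "T (- 1, 1) = q" by (simp_all add: T)
  have inW: "T z \<in> sector p q \<longleftrightarrow> \<bar>fst z\<bar> < snd z" for z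
  proof
    assume "T z \<in> sector p q"
    then obtain x y where xy: "T z = x *\<^sub>R p + y *\<^sub>R q" "0 < x" "0 < y" by (auto simp: sector_def)
    have "(snd z + fst z) / 2 = x" "(snd z - fst z) / 2 = y"
      using indep2_unique[OF ind xy(1)[unfolded T]] by simp_all
    with xy(2,3) have "snd z + fst z > 0" "snd z - fst z > 0" by (metis half_gt_zero_iff)+
    then show "\<bar>fst z\<bar> < snd z" by simp
  next
    assume "\<bar>fst z\<bar> < snd z"
    then have "(snd z + fst z) / 2 > 0 \<and> (snd z - fst z) / 2 > 0" by auto
    then show "T z \<in> sector p q" unfolding sector_def T by blast
  qed
  obtain c where c: "c > 0" "\<And>B. B \<in> sets borel \<Longrightarrow> bounded B \<Longrightarrow>
      emeasure lborel B = ennreal c * emeasure lborel {z. T z \<in> B}"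
    using chart_measure[OF ind'] unfolding T_def by blast
  have W: "sector p q \<in> sets borel" using open_sector[OF ind] by simp
  have bd: "bounded {x \<in> sector p q. N x \<le> 1 \<and> R x}" for R
    by (rule bounded_subset[OF is_norm_bounded_ball[OF N, of 1]]) auto
  let ?X = "{x \<in> sector p q. N x \<le> 1 \<and> S * M x \<le> N x}" and ?Y = "{x \<in> sector p q. N x \<le> 1}"
  have "?X = sector p q \<inter> {x. N x \<le> 1} \<inter> {x. S * M x \<le> N x}" by auto
  then have X: "?X \<in> sets borel" using W sets_norm_le[OF N M] by simp
  have "?Y = sector p q \<inter> {x. N x \<le> 1}" by auto
  then have Y: "?Y \<in> sets borel" using W sets_norm_le[OF N M] by simp
  have sub: "{z. T z \<in> ?X} \<subseteq> {z. \<bar>fst z\<bar> < snd z \<and> N (T z) \<le> 1 \<and> S * \<bar>fst z\<bar> \<le> N (T z)}"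
  proof safe
    fix z assume z: "T z \<in> sector p q" and le: "S * M (T z) \<le> N (T z)"
    from z have "\<bar>fst z\<bar> < snd z" by (simp add: inW)
    then have "\<bar>fst z\<bar> \<le> M (T z)"
      using is_norm_coord_diff[OF M p(2) q(2), of "(snd z + fst z) / 2" "(snd z - fst z) / 2"]
      unfolding T by (simp add: field_simps)
    then have "S * \<bar>fst z\<bar> \<le> S * M (T z)" using S by simp
    with le show "S * \<bar>fst z\<bar> \<le> N (T z)" by simp
  qed (auto simp: inW)
  have Tm: "(\<lambda>z. N (T z)) \<in> borel_measurable borel" by (rule is_norm_borel[OF NT])
  have "ennreal S * emeasure lborel ?X = ennreal c * (ennreal S * emeasure lborel {z. T z \<in> ?X})"
    using c(2)[OF X bd] by (simp add: mult.left_commute)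
  also have "\<dots> \<le> ennreal c * (ennreal S *
      emeasure lborel {z. \<bar>fst z\<bar> < snd z \<and> N (T z) \<le> 1 \<and> S * \<bar>fst z\<bar> \<le> N (T z)})"
    using sub sets_cone[OF NT]
    by (intro mult_left_mono emeasure_mono) auto
  also have "\<dots> \<le> ennreal c * emeasure lborel {z. \<bar>fst z\<bar> < snd z \<and> N (T z) \<le> 1}"
    using p q S by (intro mult_left_mono cone_contraction[OF NT]) (auto simp: T1)
  also have "{z. \<bar>fst z\<bar> < snd z \<and> N (T z) \<le> 1} = {z. T z \<in> ?Y}" by (auto simp: inW)
  also have "ennreal c * emeasure lborel {z. T z \<in> ?Y} = emeasure lborel ?Y"
    using c(2)[OF Y] bd[of "\<lambda>_. True"] by simp
  finally show ?thesis .
qed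

lemma sector_scale:
  assumes "a > 0" "b > 0"
  shows "sector (a *\<^sub>R p) (b *\<^sub>R q) = sector p q"
proof safe
  fix z assume "z \<in> sector (a *\<^sub>R p) (b *\<^sub>R q)"
  then obtain x y where "z = (x * a) *\<^sub>R p + (y * b) *\<^sub>R q" "0 < x" "0 < y" by (auto simp: sector_def)
  moreover from this have "0 < x * a" "0 < y * b" using assms by auto
  ultimately show "z \<in> sector p q" unfolding sector_def by blast
next
  fix z assume "z \<in> sector p q"
  then obtain x y where "z = x *\<^sub>R p + y *\<^sub>R q" "0 < x" "0 < y" by (auto simp: sector_def)
  moreover from this have "z = (x / a) *\<^sub>R (a *\<^sub>R p) + (y / b) *\<^sub>R (b *\<^sub>R q)" "0 < x / a" "0 < y / b"
    using assms by auto
  ultimately show "z \<in> sector (a *\<^sub>R p) (b *\<^sub>R q)" unfolding sector_def by blast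
qed

lemma sector_contraction:
  fixes N M :: "real^2 \<Rightarrow> real"
  assumes N: "is_norm N" and M: "is_norm M" and ind: "indep2 p q"
    and p: "N p = M p" and q: "N q = M q" and S: "S > 1"
  shows "ennreal S * emeasure lborel {x \<in> sector p q. N x \<le> 1 \<and> S * M x \<le> N x}
    \<le> emeasure lborel {x \<in> sector p q. N x \<le> 1}"
proof -
  have "p \<noteq> 0" "q \<noteq> 0" using indep2D[OF ind, of 1 0] indep2D[OF ind, of 0 1] by auto
  then have pos: "1 / N p > 0" "1 / N q > 0" using is_norm_pos[OF N] by auto
  have ind': "indep2 ((1 / N p) *\<^sub>R p) ((1 / N q) *\<^sub>R q)"
    unfolding indep2_def
  proof (intro allI impI)
    fix x y assume "x *\<^sub>R (1 / N p) *\<^sub>R p + y *\<^sub>R (1 / N q) *\<^sub>R q = 0"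
    then show "x = 0 \<and> y = 0" using indep2D[OF ind, of "x * (1 / N p)" "y * (1 / N q)"] pos by auto
  qed
  show ?thesis
    using sector_contraction_normalised[OF N M ind' _ _ _ _ S] pos p q
    unfolding sector_scale[OF pos] by (simp add: is_norm_scale[OF N] is_norm_scale[OF M])
qed
section \<open>Decomposition of the plane into sectors\<close>

lemma open_bounded_component_interval:
  fixes U :: "real set"
  assumes U: "open U" "bounded U" and c: "c \<in> components U"
  obtains a b where "a < b" "c = {a<..<b}" "a \<notin> U" "b \<notin> U" "a \<in> closure U" "b \<in> closure U"
proof -
  have sub: "c \<subseteq> U" and ne: "c \<noteq> {}" and conn: "connected c" and op: "open c"
    using c U by (auto simp: in_components_subset in_components_nonempty in_components_connected open_components)
  have bd: "bounded c" using sub U bounded_subset by blast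
  then have bdd: "bdd_above c" "bdd_below c" by (auto intro: bounded_imp_bdd_above bounded_imp_bdd_below)
  define a b where "a = Inf c" and "b = Sup c"
  have notb: "b \<notin> c"
  proof
    assume "b \<in> c"
    then obtain e where "e > 0" "ball b e \<subseteq> c" using op openE by blast
    then have "b + e / 2 \<in> c" by (auto simp: dist_real_def)
    then have "b + e / 2 \<le> b" using bdd(1) unfolding b_def by (rule cSup_upper)
    then show False using \<open>e > 0\<close> by simp
  qed
  have nota: "a \<notin> c"
  proof
    assume "a \<in> c"
    then obtain e where "e > 0" "ball a e \<subseteq> c" using op openE by blast
    then have "a - e / 2 \<in> c" by (auto simp: dist_real_def)
    then have "a \<le> a - e / 2" using bdd(2) unfolding a_def by (rule cInf_lower)
    then show False using \<open>e > 0\<close> by simp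
  qed
  have ceq: "c = {a<..<b}"
  proof (intro equalityI subsetI)
    fix x assume x: "x \<in> c"
    then have "a \<le> x" "x \<le> b" using bdd by (auto simp: a_def b_def cInf_lower cSup_upper)
    moreover have "x \<noteq> a" "x \<noteq> b" using x nota notb by auto
    ultimately show "x \<in> {a<..<b}" by simp
  next
    fix x assume x: "x \<in> {a<..<b}"
    obtain y where "y \<in> c" "y < x" using x ne cInf_lessD[of c x] by (auto simp: a_def)
    moreover obtain z where "z \<in> c" "x < z" using x ne less_cSupD[of c x] by (auto simp: b_def)
    ultimately show "x \<in> c" using connectedD_interval[OF conn, of y z x] by simp
  qed
  have ab: "a < b" using ceq ne by auto
  have fr: "frontier c = {a, b}" using ab unfolding ceq frontier_def by (simp add: interior_open insert_commute)
  have "frontier c \<subseteq> frontier U" using frontier_of_components_subset[OF c] .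
  then show ?thesis using that[OF ab ceq] fr U by (auto simp: frontier_def interior_open)
qed

definition half_plane :: "'a::real_vector \<Rightarrow> 'a \<Rightarrow> 'a set" where
  "half_plane w z = {x *\<^sub>R w + y *\<^sub>R z | x y. 0 < x}"

lemma open_half_plane: "indep2 w z \<Longrightarrow> open (half_plane w (z :: real^2))"
proof -
  have "open ({0<..} \<times> UNIV :: (real \<times> real) set)" by (intro open_Times) auto
  then show "indep2 w z \<Longrightarrow> open (half_plane w z)"
    using open_indep2_image[of w z "{0<..} \<times> UNIV"] by (simp add: half_plane_def)
qed

lemma sector_slopes:
  assumes ab: "a < b"
  shows "sector (w + a *\<^sub>R z) (w + b *\<^sub>R z) = {x *\<^sub>R (w + m *\<^sub>R z) | x m. 0 < x \<and> a < m \<and> m < b}"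
proof safe
  fix v assume "v \<in> sector (w + a *\<^sub>R z) (w + b *\<^sub>R z)"
  then obtain x y where v: "v = x *\<^sub>R (w + a *\<^sub>R z) + y *\<^sub>R (w + b *\<^sub>R z)" and xy: "0 < x" "0 < y"
    by (auto simp: sector_def)
  define m where "m = (x * a + y * b) / (x + y)"
  have "(x + y) * m = x * a + y * b" using xy by (simp add: m_def)
  then have "v = (x + y) *\<^sub>R (w + m *\<^sub>R z)"
    by (simp add: v scaleR_right_distrib scaleR_left_distrib)
  moreover have "a < m" "m < b" using xy ab by (simp_all add: m_def field_simps)
  ultimately show "\<exists>x m. v = x *\<^sub>R (w + m *\<^sub>R z) \<and> 0 < x \<and> a < m \<and> m < b"
    using xy by (intro exI[of _ "x + y"] exI[of _ m]) auto
next
  fix x m :: real assume h: "0 < x" "a < m" "m < b"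
  define t where "t = (m - a) / (b - a)"
  have t: "0 < t" "t < 1" using h by (auto simp: t_def)
  have "t * (b - a) = m - a" using ab by (simp add: t_def)
  then have m: "m = (1 - t) * a + t * b" by (simp add: algebra_simps)
  have "x *\<^sub>R (w + m *\<^sub>R z) = (x * (1 - t)) *\<^sub>R (w + a *\<^sub>R z) + (x * t) *\<^sub>R (w + b *\<^sub>R z)"
    unfolding m by (simp add: algebra_simps)
  moreover have "0 < x * (1 - t)" "0 < x * t" using h t by auto
  ultimately show "x *\<^sub>R (w + m *\<^sub>R z) \<in> sector (w + a *\<^sub>R z) (w + b *\<^sub>R z)"
    unfolding sector_def by blast
qed

text \<open>
  Rays of the half-plane are described by their slope \<open>m\<close>, the ray passing through \<open>w + m z\<close>.
  The slopes with \<open>N > M\<close> form an open set, which is bounded because \<open>N < M\<close> in the limiting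
  directions \<open>\<plusminus>z\<close>. Its components are therefore countably many bounded open intervals, at whose
  ends the norms agree, and each of them gives a sector to which \<open>sector_contraction\<close> applies.
\<close>

lemma half_plane_contraction:
  fixes N M :: "real^2 \<Rightarrow> real"
  assumes N: "is_norm N" and M: "is_norm M" and ind: "indep2 w z"
    and z: "N z < M z" and S: "S > 1"
  shows "ennreal S * emeasure lborel {x \<in> half_plane w z. N x \<le> 1 \<and> S * M x \<le> N x}
    \<le> emeasure lborel {x \<in> half_plane w z. N x \<le> 1 \<and> M x < N x}"
    (is "_ * emeasure _ ?X \<le> emeasure _ ?Y")
proof -
  define h where "h m = N (w + m *\<^sub>R z) - M (w + m *\<^sub>R z)" for m
  define U where "U = {m. h m > 0}"
  have h: "continuous_on UNIV h"
    unfolding h_def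
    by (intro continuous_intros continuous_on_compose2[OF is_norm_continuous[OF N]]
        continuous_on_compose2[OF is_norm_continuous[OF M]]) auto
  have opU: "open U" unfolding U_def by (intro open_Collect_less h continuous_intros)
  have bdU: "bounded U"
  proof -
    define r where "r = (N w + M w) / (M z - N z)"
    have "\<bar>m\<bar> \<le> r" if "m \<in> U" for m
    proof -
      have "N (w + m *\<^sub>R z) \<le> N w + \<bar>m\<bar> * N z"
        using is_norm_triangle[OF N, of w "m *\<^sub>R z"] by (simp add: is_norm_scale[OF N])
      moreover have "\<bar>m\<bar> * M z \<le> M (w + m *\<^sub>R z) + M w"
        using is_norm_triangle[OF M, of "w + m *\<^sub>R z" "- w"]
        by (simp add: is_norm_scale[OF M] is_norm_minus[OF M])
      ultimately have "\<bar>m\<bar> * (M z - N z) \<le> N w + M w"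
        using that by (simp add: U_def h_def algebra_simps)
      then show ?thesis using z by (simp add: r_def field_simps)
    qed
    then show ?thesis unfolding bounded_iff by auto
  qed
  define cone where "cone c = {x *\<^sub>R (w + m *\<^sub>R z) | x m. 0 < x \<and> m \<in> c}" for c
  have one: "open (cone c) \<and> ennreal S * emeasure lborel {x \<in> cone c. N x \<le> 1 \<and> S * M x \<le> N x}
      \<le> emeasure lborel {x \<in> cone c. N x \<le> 1}" if c: "c \<in> components U" for c
  proof -
    obtain a b where ab: "a < b" "c = {a<..<b}" "a \<notin> U" "b \<notin> U" "a \<in> closure U" "b \<in> closure U"
      using open_bounded_component_interval[OF opU bdU c] .
    have "h m \<ge> 0" if "m \<in> closure U" for m
    proof -
      have "closed {m. h m \<ge> 0}" by (intro closed_Collect_le h continuous_intros)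
      then have "closure U \<subseteq> {m. h m \<ge> 0}" by (intro closure_minimal) (auto simp: U_def)
      then show ?thesis using that by auto
    qed
    then have "h a = 0" "h b = 0" using ab by (auto simp: U_def not_less intro: antisym)
    moreover have "indep2 (w + a *\<^sub>R z) (w + b *\<^sub>R z)"
      unfolding indep2_def
    proof (intro allI impI)
      fix x y assume "x *\<^sub>R (w + a *\<^sub>R z) + y *\<^sub>R (w + b *\<^sub>R z) = 0"
      then have "(x + y) *\<^sub>R w + (x * a + y * b) *\<^sub>R z = 0"
        by (simp add: scaleR_right_distrib scaleR_left_distrib add_ac)
      from indep2D[OF ind this] have e: "y = - x" "x * a + y * b = 0" by auto
      then have "x * (a - b) = 0" by (simp add: algebra_simps)
      then show "x = 0 \<and> y = 0" using e ab by simp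
    qed
    moreover have "cone c = sector (w + a *\<^sub>R z) (w + b *\<^sub>R z)"
      unfolding sector_slopes[OF ab(1)] cone_def ab(2) by auto
    ultimately show ?thesis
      using sector_contraction[OF N M _ _ _ S] open_sector by (auto simp: h_def)
  qed
  have borel: "{x \<in> cone c. N x \<le> 1 \<and> S * M x \<le> N x} \<in> sets borel"
    "{x \<in> cone c. N x \<le> 1} \<in> sets borel" if c: "c \<in> components U" for c
  proof -
    have W: "cone c \<in> sets borel" using one[OF c] by simp
    have "{x \<in> cone c. N x \<le> 1 \<and> S * M x \<le> N x} = cone c \<inter> {x. N x \<le> 1} \<inter> {x. S * M x \<le> N x}"
      "{x \<in> cone c. N x \<le> 1} = cone c \<inter> {x. N x \<le> 1}" by auto
    then show "{x \<in> cone c. N x \<le> 1 \<and> S * M x \<le> N x} \<in> sets borel"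
      "{x \<in> cone c. N x \<le> 1} \<in> sets borel" using W sets_norm_le[OF N M] by simp_all
  qed
  have cnt: "countable (components U)"
    using open_components[OF opU] pairwise_disjoint_components[of U]
    by (intro countable_disjoint_open_subsets) (auto simp: pairwise_def disjnt_def)
  have disj: "cone c \<inter> cone d = {}" if cd: "c \<in> components U" "d \<in> components U" "c \<noteq> d" for c d
  proof (rule ccontr)
    assume "cone c \<inter> cone d \<noteq> {}"
    then obtain x m y n where e: "x *\<^sub>R (w + m *\<^sub>R z) = y *\<^sub>R (w + n *\<^sub>R z)" "0 < x" "m \<in> c" "n \<in> d"
      unfolding cone_def by blast
    then have "x *\<^sub>R w + (x * m) *\<^sub>R z = y *\<^sub>R w + (y * n) *\<^sub>R z" by (simp add: scaleR_right_distrib)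
    from indep2_unique[OF ind this] have "m = n" using e(2) by auto
    then show False using e components_nonoverlap[OF cd(1,2)] cd(3) by blast
  qed
  have Xeq: "?X = (\<Union>c\<in>components U. {x \<in> cone c. N x \<le> 1 \<and> S * M x \<le> N x})"
  proof (intro equalityI subsetI)
    fix v assume v: "v \<in> ?X"
    then obtain x y where xy: "v = x *\<^sub>R w + y *\<^sub>R z" "0 < x" by (auto simp: half_plane_def)
    define m where "m = y / x"
    have vm: "v = x *\<^sub>R (w + m *\<^sub>R z)" using xy by (simp add: m_def scaleR_right_distrib)
    have "w + m *\<^sub>R z \<noteq> 0" using indep2D[OF ind, of 1 m] by auto
    then have Mp: "M (w + m *\<^sub>R z) > 0" by (rule is_norm_pos[OF M])
    have "S * M (w + m *\<^sub>R z) \<le> N (w + m *\<^sub>R z)"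
      using v xy(2) unfolding vm by (simp add: is_norm_scale[OF N] is_norm_scale[OF M] mult.left_commute)
    moreover have "M (w + m *\<^sub>R z) < S * M (w + m *\<^sub>R z)" using S Mp by simp
    ultimately have "m \<in> U" by (simp add: U_def h_def)
    then obtain c where c: "c \<in> components U" "m \<in> c" using Union_components[of U] by blast
    then have "v \<in> cone c" using vm xy by (auto simp: cone_def)
    then show "v \<in> (\<Union>c\<in>components U. {x \<in> cone c. N x \<le> 1 \<and> S * M x \<le> N x})" using c v by auto
  next
    fix v assume "v \<in> (\<Union>c\<in>components U. {x \<in> cone c. N x \<le> 1 \<and> S * M x \<le> N x})"
    then obtain x m where v: "v = x *\<^sub>R (w + m *\<^sub>R z)" "0 < x" "N v \<le> 1" "S * M v \<le> N v"
      by (auto simp: cone_def)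
    then have "v = x *\<^sub>R w + (x * m) *\<^sub>R z" by (simp add: scaleR_right_distrib)
    then have "v \<in> half_plane w z" using v(2) unfolding half_plane_def by blast
    with v show "v \<in> ?X" by simp
  qed
  have Ysub: "(\<Union>c\<in>components U. {x \<in> cone c. N x \<le> 1}) \<subseteq> ?Y"
  proof
    fix v assume "v \<in> (\<Union>c\<in>components U. {x \<in> cone c. N x \<le> 1})"
    then obtain c x m where v: "v = x *\<^sub>R (w + m *\<^sub>R z)" "0 < x" "N v \<le> 1" and c: "c \<in> components U" "m \<in> c"
      by (auto simp: cone_def)
    then have "v = x *\<^sub>R w + (x * m) *\<^sub>R z" by (simp add: scaleR_right_distrib)
    then have H: "v \<in> half_plane w z" using v(2) unfolding half_plane_def by blast
    have "m \<in> U" using c in_components_subset by blast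
    then have "M v < N v" using v(2) unfolding v(1) U_def h_def
      by (simp add: is_norm_scale[OF N] is_norm_scale[OF M])
    with v H show "v \<in> ?Y" by simp
  qed
  have Y: "?Y \<in> sets borel"
  proof -
    have "?Y = half_plane w z \<inter> {x. N x \<le> 1} \<inter> {x. 1 * M x < N x}" by auto
    then show ?thesis using open_half_plane[OF ind] sets_norm_le(1)[OF N M, of 1] sets_norm_le(3)[OF N M, of 1] by simp
  qed
  have dX: "disjoint_family_on (\<lambda>c. {x \<in> cone c. N x \<le> 1 \<and> S * M x \<le> N x}) (components U)"
    and dY: "disjoint_family_on (\<lambda>c. {x \<in> cone c. N x \<le> 1}) (components U)"
    using disj by (fastforce simp: disjoint_family_on_def)+
  have "ennreal S * emeasure lborel ?X
      = (\<integral>\<^sup>+c. ennreal S * emeasure lborel {x \<in> cone c. N x \<le> 1 \<and> S * M x \<le> N x} \<partial>count_space (components U))"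
    unfolding Xeq using borel(1) cnt dX by (subst emeasure_UN_countable) (auto simp: nn_integral_cmult)
  also have "\<dots> \<le> (\<integral>\<^sup>+c. emeasure lborel {x \<in> cone c. N x \<le> 1} \<partial>count_space (components U))"
    using one by (intro nn_integral_mono) simp
  also have "\<dots> = emeasure lborel (\<Union>c\<in>components U. {x \<in> cone c. N x \<le> 1})"
    using borel(2) cnt dY by (subst emeasure_UN_countable) auto
  also have "\<dots> \<le> emeasure lborel ?Y"
    using Ysub Y by (intro emeasure_mono) auto
  finally show ?thesis .
qed

text \<open>
  The line through \<open>z\<close> meets the smaller set only in the origin. The two open half-planes bounded by
  that line are treated separately.
\<close>

lemma plane_contraction:
  fixes N M :: "real^2 \<Rightarrow> real"
  assumes N: "is_norm N" and M: "is_norm M" and z: "N z < M z" and S: "S > 1"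
  shows "S * measure lebesgue {x. N x \<le> 1 \<and> S * M x \<le> N x}
    \<le> measure lebesgue {x. N x \<le> 1 \<and> M x < N x}"
    (is "_ * measure _ ?X \<le> measure _ ?Y")
proof -
  \<comment> \<open>a quarter turn of \<open>z\<close>\<close>
  define w where "w = vec2 (- z $ 2, z $ 1)"
  have z0: "z \<noteq> 0" using z is_norm_zero[OF N] is_norm_zero[OF M] by auto
  have ind: "indep2 w z"
    unfolding indep2_def
  proof (intro allI impI)
    fix x y assume "x *\<^sub>R w + y *\<^sub>R z = 0"
    then have e: "y * z $ 1 = x * z $ 2" "x * z $ 1 = - (y * z $ 2)"
      by (auto simp: vec_eq_iff forall_2 w_def)
    have "x * ((z $ 1)\<^sup>2 + (z $ 2)\<^sup>2) = z $ 1 * (x * z $ 1) + z $ 2 * (x * z $ 2)"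
      by (simp add: power2_eq_square algebra_simps)
    also have "\<dots> = 0" unfolding e(2) e(1)[symmetric] by (simp add: algebra_simps)
    finally have "x * ((z $ 1)\<^sup>2 + (z $ 2)\<^sup>2) = 0" .
    moreover have "(z $ 1)\<^sup>2 + (z $ 2)\<^sup>2 \<noteq> 0" using z0 by (auto simp: vec_eq_iff forall_2 sum_power2_eq_zero_iff)
    ultimately have "x = 0" by (metis mult_eq_0_iff)
    then show "x = 0 \<and> y = 0" using e z0 by (auto simp: vec_eq_iff forall_2)
  qed
  have ind': "indep2 (- w) z"
    unfolding indep2_def
  proof (intro allI impI)
    fix x y assume "x *\<^sub>R (- w) + y *\<^sub>R z = 0"
    then show "x = 0 \<and> y = 0" using indep2D[OF ind, of "- x" y] by simp
  qed
  have H: "half_plane w z \<in> sets borel" "half_plane (- w) z \<in> sets borel"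
    using open_half_plane ind ind' by auto
  let ?X1 = "{x \<in> half_plane w z. N x \<le> 1 \<and> S * M x \<le> N x}"
  let ?X2 = "{x \<in> half_plane (- w) z. N x \<le> 1 \<and> S * M x \<le> N x}"
  let ?Y1 = "{x \<in> half_plane w z. N x \<le> 1 \<and> M x < N x}"
  let ?Y2 = "{x \<in> half_plane (- w) z. N x \<le> 1 \<and> M x < N x}"
  have "?X = {x. N x \<le> 1} \<inter> {x. S * M x \<le> N x}" "?Y = {x. N x \<le> 1} \<inter> {x. 1 * M x < N x}" by auto
  then have X: "?X \<in> sets borel" and Y: "?Y \<in> sets borel"
    using sets_norm_le[OF N M] sets_norm_le(3)[OF N M, of 1] by simp_all
  have "?X1 = half_plane w z \<inter> ?X" "?X2 = half_plane (- w) z \<inter> ?X"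
    "?Y1 = half_plane w z \<inter> ?Y" "?Y2 = half_plane (- w) z \<inter> ?Y" by auto
  then have XY: "?X1 \<in> sets borel" "?X2 \<in> sets borel" "?Y1 \<in> sets borel" "?Y2 \<in> sets borel"
    using H X Y by simp_all
  have bX: "bounded ?X" and bY: "bounded ?Y"
    by (rule bounded_subset[OF is_norm_bounded_ball[OF N, of 1]]; auto)+
  have cover: "?X \<subseteq> (?X1 \<union> ?X2) \<union> {0}"
  proof
    fix v assume v: "v \<in> ?X"
    obtain x y where xy: "v = x *\<^sub>R w + y *\<^sub>R z" using indep2_coordinates[OF ind] .
    consider "x > 0" | "x < 0" | "x = 0" by linarith
    then show "v \<in> (?X1 \<union> ?X2) \<union> {0}"
    proof cases
      case 1
      then have "v \<in> half_plane w z" using xy unfolding half_plane_def by blast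
      then show ?thesis using v by auto
    next
      case 2
      then have "v = (- x) *\<^sub>R (- w) + y *\<^sub>R z" "- x > 0" using xy by auto
      then have "v \<in> half_plane (- w) z" unfolding half_plane_def by blast
      then show ?thesis using v by auto
    next
      case 3
      have "\<bar>y\<bar> * (S * M z) \<le> \<bar>y\<bar> * N z"
        using v xy 3 by (simp add: is_norm_scale[OF N] is_norm_scale[OF M] mult.left_commute)
      moreover have "N z < S * M z"
        using z S is_norm_nonneg[OF M, of z] mult_right_mono[of 1 S "M z"] by simp
      ultimately have "y = 0" by (auto simp: mult_le_cancel_left)
      then show ?thesis using xy 3 by simp
    qed
  qed
  have disj: "?Y1 \<inter> ?Y2 = {}"
  proof (rule ccontr)
    assume "?Y1 \<inter> ?Y2 \<noteq> {}"
    then obtain x y x' y' where e: "x *\<^sub>R w + y *\<^sub>R z = x' *\<^sub>R (- w) + y' *\<^sub>R z" "0 < x" "0 < x'"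
      unfolding half_plane_def by blast
    then have "x *\<^sub>R w + y *\<^sub>R z = (- x') *\<^sub>R w + y' *\<^sub>R z" by simp
    from indep2_unique[OF ind this] e show False by simp
  qed
  have "emeasure lborel ?X \<le> emeasure lborel ((?X1 \<union> ?X2) \<union> {0})"
    using cover XY by (intro emeasure_mono) auto
  also have "\<dots> \<le> emeasure lborel (?X1 \<union> ?X2) + emeasure lborel {0 :: real^2}"
    using XY by (intro emeasure_subadditive) auto
  also have "\<dots> = emeasure lborel (?X1 \<union> ?X2)" by simp
  also have "\<dots> \<le> emeasure lborel ?X1 + emeasure lborel ?X2"
    using XY by (intro emeasure_subadditive) auto
  finally have "emeasure lborel ?X \<le> emeasure lborel ?X1 + emeasure lborel ?X2" .
  then have "ennreal S * emeasure lborel ?X \<le> ennreal S * (emeasure lborel ?X1 + emeasure lborel ?X2)"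
    by (rule mult_left_mono) simp
  also have "\<dots> = ennreal S * emeasure lborel ?X1 + ennreal S * emeasure lborel ?X2"
    by (rule distrib_left)
  finally have "ennreal S * emeasure lborel ?X
      \<le> ennreal S * emeasure lborel ?X1 + ennreal S * emeasure lborel ?X2" .
  also have "\<dots> \<le> emeasure lborel ?Y1 + emeasure lborel ?Y2"
    by (intro add_mono half_plane_contraction N M ind ind' z S)
  also have "\<dots> = emeasure lborel (?Y1 \<union> ?Y2)"
    using XY disj by (intro plus_emeasure) auto
  also have "\<dots> \<le> emeasure lborel ?Y" using Y by (intro emeasure_mono) auto
  finally show ?thesis
    using S unfolding emeasure_bounded_borel[OF X bX] emeasure_bounded_borel[OF Y bY]
    by (simp add: ennreal_mult[symmetric])
qed

section \<open>The norm of a symmetric convex body\<close>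

text \<open>
  The norm is the Minkowski gauge of \<open>K\<close>. Everything follows from the equivalence of \<open>N x \<le> t\<close>
  with \<open>x / t \<in> K\<close> for \<open>t > 0\<close>, which uses that \<open>K\<close> is closed and star-shaped about the
  interior point 0.
\<close>

lemma gauge_norm_exists:
  fixes K :: "'a::euclidean_space set"
  assumes K: "compact K" "convex K" "interior K \<noteq> {}" and sym: "K = uminus ` K"
  obtains N where "is_norm N" "K = {x. N x \<le> 1}"
proof -
  have symD: "- x \<in> K" if "x \<in> K" for x using that sym by blast
  obtain x0 e where e: "e > 0" "ball x0 e \<subseteq> K" using K(3) by (meson ex_in_conv mem_interior)
  have ball: "y \<in> K" if "norm y < e" for y
  proof -
    have "x0 + y \<in> K" "x0 - y \<in> K" using that e(2) by (auto simp: dist_norm)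
    then have "(1/2) *\<^sub>R (x0 + y) + (1/2) *\<^sub>R (- (x0 - y)) \<in> K"
      by (intro convexD[OF K(2)] symD) auto
    moreover have "(1/2) *\<^sub>R (x0 + y) + (1/2) *\<^sub>R (- (x0 - y)) = y"
    proof -
      have "(1/2) *\<^sub>R (x0 + y) + (1/2) *\<^sub>R (- (x0 - y)) = (1/2 + 1/2) *\<^sub>R y"
        unfolding scaleR_left_distrib by (simp add: algebra_simps)
      then show ?thesis by simp
    qed
    ultimately show ?thesis by simp
  qed
  define D where "D x = {t. 0 < t \<and> (1 / t) *\<^sub>R x \<in> K}" for x
  define N where "N x = Inf (D x)" for x
  have bdd: "bdd_below (D x)" for x by (auto simp: D_def intro!: bdd_belowI[of _ 0])
  have ne: "D x \<noteq> {}" for x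
  proof -
    define t where "t = norm x / e + 1"
    have t: "t > 0" using e by (simp add: t_def add_nonneg_pos)
    have "norm x < t * e" using e by (simp add: t_def distrib_right)
    then have "norm ((1 / t) *\<^sub>R x) < e" using t by (simp add: field_simps)
    then have "t \<in> D x" using t ball by (simp add: D_def)
    then show ?thesis by auto
  qed
  have up: "t' \<in> D x" if "t \<in> D x" "t \<le> t'" for t t' x
  proof -
    have t: "0 < t" "(1 / t) *\<^sub>R x \<in> K" using that by (auto simp: D_def)
    have "(t / t') *\<^sub>R ((1 / t) *\<^sub>R x) + (1 - t / t') *\<^sub>R 0 \<in> K"
      using t that ball[of 0] e by (intro convexD[OF K(2)]) (auto simp: field_simps)
    then show ?thesis using t that by (simp add: D_def)
  qed
  have N0: "N x \<ge> 0" for x unfolding N_def by (intro cInf_greatest ne) (auto simp: D_def)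
  have le: "N x \<le> t \<longleftrightarrow> (1 / t) *\<^sub>R x \<in> K" if t: "t > 0" for x t
  proof
    assume "(1 / t) *\<^sub>R x \<in> K"
    then show "N x \<le> t" unfolding N_def using t bdd by (intro cInf_lower) (auto simp: D_def)
  next
    assume Nt: "N x \<le> t"
    have "t + 1 / real (Suc n) \<in> D x" for n
    proof -
      have "0 < 1 / real (Suc n)" by simp
      then have "Inf (D x) < t + 1 / real (Suc n)" using Nt unfolding N_def by linarith
      then obtain u where "u \<in> D x" "u < t + 1 / real (Suc n)" using cInf_lessD[OF ne] by blast
      then show ?thesis using up by simp
    qed
    then have "\<forall>n. (1 / (t + 1 / real (Suc n))) *\<^sub>R x \<in> K" by (simp add: D_def)
    moreover have "(\<lambda>n. (1 / (t + 1 / real (Suc n))) *\<^sub>R x) \<longlonglongrightarrow> (1 / (t + 0)) *\<^sub>R x"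
      using t by (intro tendsto_intros LIMSEQ_Suc[OF lim_1_over_n]) auto
    ultimately show "(1 / t) *\<^sub>R x \<in> K"
      using closed_sequentially[OF compact_imp_closed[OF K(1)]] by fastforce
  qed
  \<comment> \<open>norms are compared through their sublevel sets at positive levels\<close>
  have eqI: "a = b" if "0 \<le> a" "0 \<le> b" "\<And>t. t > 0 \<Longrightarrow> a \<le> t \<longleftrightarrow> b \<le> t" for a b :: real
    using that(1,2) that(3)[of "(a + b) / 2"] by (cases a b rule: linorder_cases) auto
  have Npos: "N (c *\<^sub>R x) = c * N x" if c: "c > 0" for c x
  proof (rule eqI)
    fix t :: real assume t: "t > 0"
    have "N (c *\<^sub>R x) \<le> t \<longleftrightarrow> N x \<le> t / c"
      using le[OF t, of "c *\<^sub>R x"] le[of "t / c" x] t c by (simp add: field_simps)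
    then show "N (c *\<^sub>R x) \<le> t \<longleftrightarrow> c * N x \<le> t" using c by (simp add: field_simps)
  qed (use c N0 in auto)
  have Nneg: "N (- x) = N x" for x
    using symD[of "_ *\<^sub>R x"] symD[of "- (_ *\<^sub>R x)"] by (intro eqI N0) (auto simp: le)
  have Nz: "N 0 = 0" using le[of _ 0] ball[of 0] e by (intro eqI N0) auto
  have "N (c *\<^sub>R x) = \<bar>c\<bar> * N x" for c x
    using Npos[of c x] Npos[of "- c" x] Nneg[of "c *\<^sub>R x"] Nz by (cases c "0 :: real" rule: linorder_cases) auto
  moreover have "N (x + y) \<le> N x + N y" for x y
  proof (rule field_le_epsilon)
    fix d :: real assume d: "d > 0"
    define s where "s = N x + d / 2"
    define t where "t = N y + d / 2"
    have st: "s > 0" "t > 0" using N0 d by (auto simp: s_def t_def add_nonneg_pos)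
    have "N x \<le> s" "N y \<le> t" using d by (simp_all add: s_def t_def)
    then have "(1 / s) *\<^sub>R x \<in> K" "(1 / t) *\<^sub>R y \<in> K" using st by (simp_all only: le)
    then have "(s / (s + t)) *\<^sub>R ((1 / s) *\<^sub>R x) + (t / (s + t)) *\<^sub>R ((1 / t) *\<^sub>R y) \<in> K"
      using st by (intro convexD[OF K(2)]) (auto simp: add_divide_distrib[symmetric])
    then have "(1 / (s + t)) *\<^sub>R (x + y) \<in> K" using st by (simp add: scaleR_right_distrib)
    then have "N (x + y) \<le> s + t" using le[of "s + t" "x + y"] st by simp
    then show "N (x + y) \<le> N x + N y + d" by (simp add: s_def t_def)
  qed
  moreover have "N x > 0" if "x \<noteq> 0" for x
  proof (rule ccontr)
    assume "\<not> N x > 0"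
    then have z: "N x = 0" using N0[of x] by simp
    obtain B where B: "B > 0" "\<And>y. y \<in> K \<Longrightarrow> norm y \<le> B"
      using compact_imp_bounded[OF K(1)] by (auto simp: bounded_pos)
    have p: "norm x / (2 * B) > 0" using that B by simp
    then have "(1 / (norm x / (2 * B))) *\<^sub>R x \<in> K" using le[OF p, of x] z by simp
    from B(2)[OF this] show False using B(1) that by simp
  qed
  ultimately have "is_norm N" unfolding is_norm_def by blast
  moreover have "K = {x. N x \<le> 1}" using le[of 1] by auto
  ultimately show ?thesis using that by blast
qed

section \<open>Log-concavity\<close>

text \<open>
  The hypothesis is the conclusion up to an error of second order in \<open>y - x\<close>. Cutting the interval into
  \<open>n\<close> equal steps, each of which is bounded with the help of monotonicity by the value of \<open>\<theta>\<close> at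
  \<open>x\<close>, makes the total error vanish as \<open>n\<close> grows. Both signs of \<open>y - x\<close> are allowed.
\<close>

lemma supergradient_from_exp_bound:
  fixes F \<theta> :: "real \<Rightarrow> real"
  assumes anti: "\<And>x y. x \<le> y \<Longrightarrow> \<theta> y \<le> \<theta> x"
    and step: "\<And>x y. F y - F x \<le> (exp (2 * (y - x)) - 1) * \<theta> x"
  shows "F y - F x \<le> 2 * (y - x) * \<theta> x"
proof -
  have bound: "F y - F x \<le> real n * (exp (2 * (y - x) / real n) - 1) * \<theta> x" if n: "n > 0" for n
  proof -
    define d where "d = (y - x) / real n"
    have nd: "real n * d = y - x" using n by (simp add: d_def)
    have ed: "2 * (y - x) / real n = 2 * d" by (simp add: d_def)
    have "F y - F x = (\<Sum>i<n. F (x + real (Suc i) * d) - F (x + real i * d))"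
      using nd by (subst sum_lessThan_telescope) simp
    also have "\<dots> \<le> (\<Sum>i<n. (exp (2 * d) - 1) * \<theta> x)"
    proof (rule sum_mono)
      fix i
      have "F (x + real (Suc i) * d) - F (x + real i * d) \<le> (exp (2 * d) - 1) * \<theta> (x + real i * d)"
        using step[of "x + real (Suc i) * d" "x + real i * d"] by (simp add: algebra_simps)
      also have "\<dots> \<le> (exp (2 * d) - 1) * \<theta> x"
      proof (cases "d \<ge> 0")
        case True
        then show ?thesis by (intro mult_left_mono anti) auto
      next
        case False
        then show ?thesis
          by (intro mult_left_mono_neg anti) (auto simp: mult_nonneg_nonpos)
      qed
      finally show "F (x + real (Suc i) * d) - F (x + real i * d) \<le> (exp (2 * d) - 1) * \<theta> x" .
    qed
    also have "\<dots> = real n * (exp (2 * d) - 1) * \<theta> x" by simp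
    finally show ?thesis unfolding ed .
  qed
  have "(\<lambda>n. real n * (exp (c / real n) - 1)) \<longlonglongrightarrow> c" for c :: real
    by real_asymp
  then have "(\<lambda>n. real n * (exp (2 * (y - x) / real n) - 1) * \<theta> x) \<longlonglongrightarrow> 2 * (y - x) * \<theta> x"
    by (intro tendsto_mult_right)
  then show ?thesis
    using bound by (intro tendsto_lowerbound) (auto intro!: eventually_sequentiallyI[of 1])
qed

lemma is_norm_cmult: "is_norm N \<Longrightarrow> c > 0 \<Longrightarrow> is_norm (\<lambda>x. c * N x)"
  by (auto simp: is_norm_def mult_ac simp flip: distrib_left)

lemma measure_scaled_ball_part:
  fixes N M :: "real^2 \<Rightarrow> real"
  assumes N: "is_norm N" and M: "is_norm M" and s: "s > 0"
  shows "measure lebesgue {x. N x \<le> s \<and> r * M x < N x} = s\<^sup>2 * measure lebesgue {x. N x \<le> 1 \<and> r * M x < N x}"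
    and "measure lebesgue {x. N x \<le> s} = s\<^sup>2 * measure lebesgue {x. N x \<le> 1}"
proof -
  have lin: "linear ((*\<^sub>R) s :: real^2 \<Rightarrow> real^2)" by (rule linearI) (simp_all add: algebra_simps)
  have scale: "measure lebesgue ((*\<^sub>R) s ` A) = s\<^sup>2 * measure lebesgue A"
    if "A \<in> lmeasurable" for A :: "(real^2) set"
    using measure_linear_image[OF lin that] s by simp
  have image: "(*\<^sub>R) s ` {x. P x} = {x. P ((1 / s) *\<^sub>R x)}" for P :: "real^2 \<Rightarrow> bool"
  proof (intro equalityI subsetI)
    fix x assume "x \<in> {x. P ((1 / s) *\<^sub>R x)}"
    then show "x \<in> (*\<^sub>R) s ` {x. P x}" using s by (intro image_eqI[of _ _ "(1 / s) *\<^sub>R x"]) auto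
  qed (use s in auto)
  have m1: "{x. N x \<le> 1} \<in> lmeasurable"
    using sets_norm_le(1)[OF N M, of 1] is_norm_bounded_ball[OF N, of 1]
    by (intro bounded_set_imp_lmeasurable) auto
  have "{x. N x \<le> 1 \<and> r * M x < N x} = {x. N x \<le> 1} \<inter> {x. r * M x < N x}" by auto
  then have m2: "{x. N x \<le> 1 \<and> r * M x < N x} \<in> lmeasurable"
    using sets_norm_le(3)[OF N M, of r] m1 by (auto intro: fmeasurable_Int_fmeasurable)
  show "measure lebesgue {x. N x \<le> s} = s\<^sup>2 * measure lebesgue {x. N x \<le> 1}"
    using scale[OF m1] s unfolding image by (simp add: is_norm_scale[OF N] field_simps)
  show "measure lebesgue {x. N x \<le> s \<and> r * M x < N x} = s\<^sup>2 * measure lebesgue {x. N x \<le> 1 \<and> r * M x < N x}"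
    using scale[OF m2] s unfolding image
    by (simp add: is_norm_scale[OF N] is_norm_scale[OF M] field_simps)
qed

lemma measure_balls_pos:
  fixes N M :: "real^2 \<Rightarrow> real"
  assumes N: "is_norm N" and M: "is_norm M" and r: "r > 0"
  shows "measure lebesgue {x. N x \<le> r \<and> M x \<le> 1} > 0"
proof -
  have "open {x. N x < r \<and> M x < 1}"
    by (intro open_Collect_conj open_Collect_less is_norm_continuous N M continuous_intros)
  moreover have "0 \<in> {x. N x < r \<and> M x < 1}" using r by (simp add: is_norm_zero N M)
  ultimately obtain e where e: "e > 0" "ball 0 e \<subseteq> {x. N x < r \<and> M x < 1}"
    using openE by blast
  have "{x. N x \<le> r \<and> M x \<le> 1} = {x. N x \<le> r} \<inter> {x. M x \<le> 1}" by auto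
  moreover have "\<dots> \<in> sets borel" using sets_norm_le(1)[OF N M] sets_norm_le(1)[OF M N] by simp
  moreover have "bounded ({x. N x \<le> r} \<inter> {x. M x \<le> 1})"
    using is_norm_bounded_ball[OF N] bounded_Int by blast
  ultimately have m: "{x. N x \<le> r \<and> M x \<le> 1} \<in> lmeasurable"
    by (intro bounded_set_imp_lmeasurable) auto
  have "0 < measure lebesgue (ball (0 :: real^2) e)" using e by (simp add: content_ball_pos)
  also have "\<dots> \<le> measure lebesgue {x. N x \<le> r \<and> M x \<le> 1}"
    using e(2) m by (intro measure_mono_fmeasurable) force+
  finally show ?thesis .
qed

text \<open>
  The fraction \<open>\<theta> r = k r / h r\<close> is half the logarithmic derivative of \<open>h\<close>. It is
  nonincreasing because, as long as both kinds of rays occur, \<open>k r / r\<close> is nonincreasing and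
  \<open>j r / r\<close> is nondecreasing, and it
  satisfies \<open>h b \<le> h a (1 + ((b / a)\<^sup>2 - 1) \<theta> a)\<close> for \<open>b\<close> on either side of \<open>a\<close>,
  since passing from \<open>a\<close> to \<open>b\<close> dilates the part counted by \<open>k a\<close> and leaves the other part
  inside \<open>L\<close>. Hence \<open>2 \<theta> (exp x)\<close> is a supergradient of \<open>x \<mapsto> ln (h (exp x))\<close>.
\<close>

lemma balls_log_concave:
  fixes N M :: "real^2 \<Rightarrow> real"
  assumes N: "is_norm N" and M: "is_norm M"
  defines "h \<equiv> \<lambda>r. measure lebesgue {x. N x \<le> r \<and> M x \<le> 1}"
  assumes l: "0 \<le> l" "l \<le> 1"
  shows "h (exp s) powr (1 - l) * h (exp t) powr l \<le> h (exp ((1 - l) * s + l * t))"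
proof -
  define k where "k r = measure lebesgue {x. N x \<le> r \<and> r * M x < N x}" for r
  define j where "j r = measure lebesgue {x. M x \<le> 1 \<and> N x \<le> r * M x}" for r
  \<comment> \<open>for \<open>r K \<subseteq> L\<close> there is no ray with \<open>N < r M\<close>, as
    \<open>plane_contraction\<close> would need; the value 1 is right because \<open>h\<close> is proportional to
    \<open>r\<^sup>2\<close> there, and it makes monotonicity from such \<open>r\<close> immediate\<close>
  define \<theta> where "\<theta> r = (if \<forall>x. r * M x \<le> N x then 1 else k r / h r)" for r
  have sets: "{x. N x \<le> a \<and> r * M x < N x} \<in> lmeasurable"
    "{x. M x \<le> 1 \<and> N x \<le> r * M x} \<in> lmeasurable"
    "{x. N x \<le> a \<and> M x \<le> 1} \<in> lmeasurable" "{x. N x \<le> a} \<in> lmeasurable" for a r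
  proof -
    have n: "{x. N x \<le> a} \<in> lmeasurable" and m: "{x. M x \<le> 1} \<in> lmeasurable"
      using sets_norm_le(1)[OF N M] sets_norm_le(1)[OF M N] is_norm_bounded_ball[OF N]
        is_norm_bounded_ball[OF M]
      by (auto intro!: bounded_set_imp_lmeasurable)
    have e: "{x. N x \<le> a \<and> r * M x < N x} = {x. N x \<le> a} \<inter> {x. r * M x < N x}"
      "{x. M x \<le> 1 \<and> N x \<le> r * M x} = {x. M x \<le> 1} - {x. r * M x < N x}"
      "{x. N x \<le> a \<and> M x \<le> 1} = {x. N x \<le> a} \<inter> {x. M x \<le> 1}" by auto
    have "{x. r * M x < N x} \<in> sets lebesgue" using sets_norm_le(3)[OF N M] by simp
    then show "{x. N x \<le> a \<and> r * M x < N x} \<in> lmeasurable"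
      "{x. M x \<le> 1 \<and> N x \<le> r * M x} \<in> lmeasurable"
      "{x. N x \<le> a \<and> M x \<le> 1} \<in> lmeasurable" "{x. N x \<le> a} \<in> lmeasurable"
      unfolding e using n m by (auto intro: fmeasurable_Int_fmeasurable fmeasurable_Diff)
  qed
  have hpos: "h r > 0" if "r > 0" for r unfolding h_def by (rule measure_balls_pos[OF N M that])
  have split: "h r = k r + j r" if r: "r > 0" for r
  proof -
    have "{x. N x \<le> r \<and> M x \<le> 1} = {x. N x \<le> r \<and> r * M x < N x} \<union> {x. M x \<le> 1 \<and> N x \<le> r * M x}"
    proof safe
      fix x assume "N x \<le> r" "r * M x < N x"
      then have "r * M x < r * 1" by simp
      then show "M x \<le> 1" using r by (simp add: mult_less_cancel_left_pos)
    next
      fix x assume "M x \<le> 1" "N x \<le> r * M x"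
      moreover have "r * M x \<le> r * 1" using r \<open>M x \<le> 1\<close> by (intro mult_left_mono) auto
      ultimately show "N x \<le> r" by simp
    qed auto
    moreover have "measure lebesgue ({x. N x \<le> r \<and> r * M x < N x} \<union> {x. M x \<le> 1 \<and> N x \<le> r * M x})
        = k r + j r"
      unfolding k_def j_def using sets by (intro measure_Un_AE) auto
    ultimately show ?thesis by (simp add: h_def)
  qed
  have kj0: "k r \<ge> 0" "j r \<ge> 0" for r by (simp_all add: k_def j_def)
  have growth: "h b \<le> h a * (1 + ((b / a)\<^sup>2 - 1) * \<theta> a)" if ab: "a > 0" "b > 0" for a b
  proof (cases "\<forall>x. a * M x \<le> N x")
    case True
    have "h b \<le> measure lebesgue {x. N x \<le> b}"
      unfolding h_def using sets by (intro measure_mono_fmeasurable) auto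
    also have "\<dots> = (b / a)\<^sup>2 * measure lebesgue {x. N x \<le> a}"
      using measure_scaled_ball_part(2)[OF N M ab(1)] measure_scaled_ball_part(2)[OF N M ab(2)] ab
      by (simp add: power_divide)
    also have "{x. N x \<le> a} = {x. N x \<le> a \<and> M x \<le> 1}"
    proof safe
      fix x assume "N x \<le> a"
      with True have "a * M x \<le> a * 1" by (metis mult_1_right order_trans)
      then show "M x \<le> 1" using ab by simp
    qed
    finally show ?thesis using True by (simp add: \<theta>_def h_def mult.commute)
  next
    case False
    have "h b \<le> measure lebesgue ({x. N x \<le> b \<and> a * M x < N x} \<union> {x. M x \<le> 1 \<and> N x \<le> a * M x})"
      unfolding h_def using sets by (intro measure_mono_fmeasurable) auto
    also have "\<dots> \<le> measure lebesgue {x. N x \<le> b \<and> a * M x < N x} + j a"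
      unfolding j_def using sets by (intro measure_Un_le) auto
    also have "measure lebesgue {x. N x \<le> b \<and> a * M x < N x} = (b / a)\<^sup>2 * k a"
      using measure_scaled_ball_part(1)[OF N M ab(1), of a] measure_scaled_ball_part(1)[OF N M ab(2), of a] ab
      by (simp add: k_def power_divide)
    also have "(b / a)\<^sup>2 * k a + j a = h a * (1 + ((b / a)\<^sup>2 - 1) * \<theta> a)"
    proof -
      have "h a * \<theta> a = k a" using hpos[OF ab(1)] unfolding \<theta>_def if_not_P[OF False] by simp
      then have "h a * (1 + ((b / a)\<^sup>2 - 1) * \<theta> a) = h a + ((b / a)\<^sup>2 - 1) * k a"
        by (simp add: algebra_simps)
      then show ?thesis by (simp add: split[OF ab(1)] algebra_simps)
    qed
    finally show ?thesis .
  qed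
  have anti: "\<theta> b \<le> \<theta> a" if ab: "0 < a" "a \<le> b" for a b
  proof (cases "a = b \<or> (\<forall>x. a * M x \<le> N x)")
    case True
    have "k b / h b \<le> 1" using split[of b] hpos[of b] kj0[of b] ab by simp
    then show ?thesis using True by (auto simp: \<theta>_def)
  next
    case False
    then obtain z where z: "N z < a * M z" and lt: "a < b" using ab by (auto simp: not_le)
    have "a * M z \<le> b * M z" using ab is_norm_nonneg[OF M] by (intro mult_right_mono) auto
    then have notb: "\<not> (\<forall>x. b * M x \<le> N x)" using z by (auto simp: not_le intro!: exI[of _ z])
    have S: "b / a > 1" using ab lt by simp
    \<comment> \<open>\<open>k r = r\<^sup>2 \<kappa> r\<close> by dilation, so the contraction of \<open>\<kappa>\<close> by \<open>b / a\<close> is what is needed\<close>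
    have kk: "a * k b \<le> b * k a"
    proof -
      let ?\<kappa> = "\<lambda>r. measure lebesgue {x. N x \<le> 1 \<and> r * M x < N x}"
      have "b / a * measure lebesgue {x. N x \<le> 1 \<and> b / a * (a * M x) \<le> N x} \<le> ?\<kappa> a"
        by (rule plane_contraction[OF N is_norm_cmult[OF M ab(1)] z S])
      moreover have "?\<kappa> b \<le> measure lebesgue {x. N x \<le> 1 \<and> b / a * (a * M x) \<le> N x}"
      proof -
        have "{x. N x \<le> 1 \<and> b / a * (a * M x) \<le> N x} = {x. N x \<le> 1} \<inter> {x. b * M x \<le> N x}"
          using ab by auto
        then have "{x. N x \<le> 1 \<and> b / a * (a * M x) \<le> N x} \<in> lmeasurable"
          using sets(4) sets_norm_le(2)[OF N M] by (auto intro: fmeasurable_Int_fmeasurable)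
        then show ?thesis using sets ab by (intro measure_mono_fmeasurable) auto
      qed
      ultimately have "b / a * ?\<kappa> b \<le> ?\<kappa> a" using S by (meson dual_order.trans less_imp_le mult_left_mono zero_less_one order_less_trans)
      then have "b * ?\<kappa> b \<le> a * ?\<kappa> a" using ab by (simp add: field_simps)
      then have "(a * b) * (b * ?\<kappa> b) \<le> (a * b) * (a * ?\<kappa> a)" using ab by (intro mult_left_mono) auto
      then show ?thesis
        using measure_scaled_ball_part(1)[OF N M, of a a] measure_scaled_ball_part(1)[OF N M, of b b] ab
        by (simp add: k_def power2_eq_square mult_ac)
    qed
    \<comment> \<open>the contraction with \<open>M\<close> and \<open>N / b\<close> in the roles of \<open>N\<close> and
      \<open>a M\<close>, provided that some ray leaves \<open>b K\<close> before \<open>L\<close>; otherwise \<open>k b = 0\<close>\<close>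
    have jj: "k b * j a \<le> k a * j b"
    proof (cases "\<exists>y. b * M y < N y")
      case True
      then obtain y where y: "M y < 1 / b * N y" using ab by (auto simp: field_simps)
      have "b / a * measure lebesgue {x. M x \<le> 1 \<and> b / a * (1 / b * N x) \<le> M x}
          \<le> measure lebesgue {x. M x \<le> 1 \<and> 1 / b * N x < M x}"
        using ab by (intro plane_contraction[OF M is_norm_cmult[OF N] y S]) auto
      also have "{x. M x \<le> 1 \<and> b / a * (1 / b * N x) \<le> M x} = {x. M x \<le> 1 \<and> N x \<le> a * M x}"
        using ab by (auto simp: field_simps)
      also have "measure lebesgue {x. M x \<le> 1 \<and> 1 / b * N x < M x} \<le> j b"
      proof -
        have "{x. M x \<le> 1 \<and> 1 / b * N x < M x} = {x. M x \<le> 1} \<inter> {x. 1 / b * N x < M x}" by auto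
        moreover have "\<dots> \<in> sets lebesgue"
          using sets_norm_le(1)[OF M N] sets_norm_le(3)[OF M N, of "1 / b"] by (intro sets.Int) auto
        ultimately show ?thesis
          unfolding j_def using ab sets by (intro measure_mono_fmeasurable) (auto simp: field_simps)
      qed
      finally have jab: "b * j a \<le> a * j b" using ab by (simp add: j_def field_simps)
      have "(a * k b) * (b * j a) \<le> (b * k a) * (a * j b)"
        using kj0 ab by (intro mult_mono[OF kk jab]) auto
      then have "(a * b) * (k b * j a) \<le> (a * b) * (k a * j b)" by (simp add: mult_ac)
      then show ?thesis using ab by (simp add: mult_le_cancel_left_pos)
    next
      case False
      then have "{x. N x \<le> b \<and> b * M x < N x} = {}" by auto
      then have "k b = 0" unfolding k_def by (simp only: measure_empty)
      then show ?thesis using kj0 by simp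
    qed
    have "k b / h b \<le> k a / h a"
    proof -
      have "k b * h a \<le> k a * h b"
        using jj ab split[of a] split[of b] by (simp add: algebra_simps)
      then show ?thesis using hpos[of a] hpos[of b] ab by (simp add: field_simps)
    qed
    moreover have "\<not> (\<forall>x. a * M x \<le> N x)" using False by blast
    ultimately show ?thesis using notb by (simp only: \<theta>_def if_False)
  qed
  define F where "F x = ln (h (exp x))" for x
  have step: "F y - F x \<le> (exp (2 * (y - x)) - 1) * \<theta> (exp x)" for x y
  proof -
    have p: "h (exp x) > 0" "h (exp y) > 0" by (simp_all add: hpos)
    have "F y - F x = ln (h (exp y) / h (exp x))" using p by (simp add: F_def ln_div)
    also have "\<dots> \<le> h (exp y) / h (exp x) - 1" using p by (intro ln_le_minus_one) simp
    also have "\<dots> \<le> ((exp y / exp x)\<^sup>2 - 1) * \<theta> (exp x)"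
      using growth[of "exp x" "exp y"] p by (simp add: field_simps)
    also have "(exp y / exp x)\<^sup>2 = exp (2 * (y - x))"
      by (simp only: exp_diff[symmetric] exp_double)
    finally show ?thesis .
  qed
  have super: "F y - F x \<le> 2 * (y - x) * \<theta> (exp x)" for x y
    by (rule supergradient_from_exp_bound[of "\<lambda>x. \<theta> (exp x)", OF _ step]) (simp add: anti)
  define m where "m = (1 - l) * s + l * t"
  have "(1 - l) * F s + l * F t \<le> (1 - l) * (F m + 2 * (s - m) * \<theta> (exp m)) + l * (F m + 2 * (t - m) * \<theta> (exp m))"
    using super[of s m] super[of t m] l by (intro add_mono mult_left_mono) auto
  also have "\<dots> = F m + 2 * \<theta> (exp m) * ((1 - l) * s + l * t - m)" by (simp add: algebra_simps)
  also have "\<dots> = F m" by (simp add: m_def)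
  finally have "exp ((1 - l) * F s + l * F t) \<le> exp (F m)" by simp
  moreover have "h (exp x) \<noteq> 0" for x using hpos[of "exp x"] by simp
  ultimately show ?thesis
    by (simp add: F_def powr_def exp_add hpos m_def)
qed

theorem theorem2:
  fixes K L :: "(real ^ 2) set"
  assumes "compact K" and "convex K" and "interior K \<noteq> {}" and "K = uminus ` K"
    and "compact L" and "convex L" and "interior L \<noteq> {}" and "L = uminus ` L"
  shows "(\<forall>t::real. measure lebesgue ((*\<^sub>R) (exp t) ` K \<inter> L) > 0) \<and>
    (\<forall>(s::real) (t::real). \<forall>l\<in>{0..1::real}.
      measure lebesgue ((*\<^sub>R) (exp ((1 - l) * s + l * t)) ` K \<inter> L)
      \<ge> measure lebesgue ((*\<^sub>R) (exp s) ` K \<inter> L) powr (1 - l)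
        * measure lebesgue ((*\<^sub>R) (exp t) ` K \<inter> L) powr l)"
proof -
  obtain N where N: "is_norm N" "K = {x. N x \<le> 1}" using gauge_norm_exists[OF assms(1-4)] .
  obtain M where M: "is_norm M" "L = {x. M x \<le> 1}" using gauge_norm_exists[OF assms(5-8)] .
  have eq: "(*\<^sub>R) (exp t) ` K \<inter> L = {x. N x \<le> exp t \<and> M x \<le> 1}" for t
  proof (intro equalityI subsetI)
    fix x assume "x \<in> {x. N x \<le> exp t \<and> M x \<le> 1}"
    then show "x \<in> (*\<^sub>R) (exp t) ` K \<inter> L"
      by (auto simp: N(2) M(2) is_norm_scale[OF N(1)] field_simps intro!: image_eqI[of _ _ "(1 / exp t) *\<^sub>R x"])
  qed (auto simp: N(2) M(2) is_norm_scale[OF N(1)])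
  show ?thesis
    unfolding eq using measure_balls_pos[OF N(1) M(1)] balls_log_concave[OF N(1) M(1)] by simp
qed

end
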